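(* The collection $\{\mathcal{S}_\beta:\beta\in\mathcal{B}\}$ is a $\mathrm{GL}_n(\mathbb{R})$-invariant stratification of $V_n\smallsetminus\{0\}$, i.e. it is a finite collection of $\mathrm{GL}_n(\mathbb{R})$-invariant subsets such that: (i) $V_n\smallsetminus\{0\}=\bigcup_{\beta\in\mathcal{B}}\mathcal{S}_\beta$, and this union is disjoint. (ii) For every $\beta\in\mathcal{B}$, $\overline{\mathcal{S}_\beta}\smallsetminus\mathcal{S}_\beta\subset\bigcup_{\beta'\in\mathcal{B},\,\|\beta'\|>\|\beta\|}\mathcal{S}_{\beta'}$, where $\overline{\mathcal{S}_\beta}$ is the closure of $\mathcal{S}_\beta$ in $V_n\smallsetminus\{0\}$ with respect to the usual topology. In particular, each $\mathcal{S}_\beta$ is a locally closed subset of $V_n\smallsetminus\{0\}$. Furthermore, for any $\beta\in\mathcal{B}$: (iii) $W_\beta\smallsetminus\{0\}\subset\mathcal{S}_\beta\cup\bigcup_{\beta'\in\mathcal{B},\,\|\beta'\|>\|\beta\|}\mathcal{S}_{\beta'}$. (iv) $\mathcal{S}_\beta\cap W_\beta=\{\mu\in\mathcal{S}_\beta:\beta_\mu=\beta\}$. (v) $\mathcal{S}_\beta=\mathrm{O}(n).(\mathcal{S}_\beta\cap W_\beta)$.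
   Context: Let $n\ge 1$ and let $V_n=\Lambda^2(\mathbb{R}^n)^*\otimes\mathbb{R}^n$ be the vector space of skew-symmetric bilinear maps $\mu:\mathbb{R}^n\times\mathbb{R}^n\to\mathbb{R}^n$, with the action of $\mathrm{GL}_n(\mathbb{R})$ given by $(g.\mu)(X,Y)=g\mu(g^{-1}X,g^{-1}Y)$. Let $e_1,\dots,e_n$ be the canonical basis of $\mathbb{R}^n$. For $i<j$ and any $k$, let $v_{ijk}\in V_n$ be defined by $v_{ijk}(e_i,e_j)=-v_{ijk}(e_j,e_i)=e_k$ and zero on all other pairs of basis vectors; these form a basis of $V_n$, and one writes $\mu=\sum_{i<j,\,k}\mu_{ij}^kv_{ijk}$. Let $\mathfrak{t}$ be the space of real diagonal $n\times n$ matrices with $\langle\alpha,\beta\rangle=\operatorname{tr}(\alpha\beta^t)$ and $\|\cdot\|$ the associated norm, and put $\alpha_{ij}^k=E_{kk}-E_{ii}-E_{jj}\in\mathfrak{t}$, where $E_{rs}$ is the matrix with only nonzero entry $1$ in position $rs$. For nonzero $\mu\in V_n$, $\beta_\mu\in\mathfrak{t}$ is the unique vector of minimal norm in the convex hull of $\{\alpha_{ij}^k:\mu_{ij}^k\neq0\}$. For $\beta\in\mathfrak{t}$ define $$\mathcal{S}_\beta=\{\mu\in V_n\smallsetminus\{0\}:\beta\text{ is an element of maximal norm in }\{\beta_{g.\mu}:g\in\mathrm{GL}_n(\mathbb{R})\}\},$$ $$W_\beta=\{\mu\in V_n:\langle\beta,\alpha_{ij}^k\rangle\ge\|\beta\|^2\text{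 for all }i<j,k\text{ with }\mu_{ij}^k\neq0\}.$$ Let $\overline{\mathfrak{t}^+}$ be the set of diagonal matrices $\operatorname{diag}(a_1,\dots,a_n)$ with $a_1\le\dots\le a_n$, and $\mathcal{B}=\{\beta\in\overline{\mathfrak{t}^+}:\mathcal{S}_\beta\neq\emptyset\}$. A finite collection $\{S_i:i\in I\}$ of subsets of a topological space $X$ is a stratification of $X$ if $X$ is the disjoint union of the $S_i$ and there is a partial order $>$ on $I$ with $\overline{S_i}\subset S_i\cup\bigcup_{j>i}S_j$ for all $i\in I$. Here the partial order on $\mathcal{B}$ is: $\beta'>\beta$ if and only if $\|\beta'\|>\|\beta\|$. *)

theory Defs
  imports "HOL-Analysis.Analysis"
begin

text \<open>
  The dimension \<open>n \<ge> 1\<close> is the cardinality of an arbitrary finite linearly ordered index type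
  \<open>'n\<close>; the linear order is needed for \<open>i < j\<close> and for \<open>a\<^sub>1 \<le> \<dots> \<le> a\<^sub>n\<close>.  The explicit
  type constructor \<^type>\<open>vec\<close> is used in the synonyms because the notation for \<open>real ^ 'n\<close> forces
  the sort of \<open>'n\<close> to be exactly \<^class>\<open>finite\<close>.
\<close>

type_synonym 'n rvec = "(real, 'n) vec"
type_synonym 'n rmat = "((real, 'n) vec, 'n) vec"
type_synonym 'n product = "'n rvec \<Rightarrow> 'n rvec \<Rightarrow> 'n rvec"


section \<open>Skew-symmetric bilinear products and the action of the general linear group\<close>

definition V_space :: "('n::finite) product set" where
  "V_space = {\<mu>. bilinear \<mu> \<and> (\<forall>X Y. \<mu> X Y = - \<mu> Y X)}"

definition V_nz :: "('n::finite) product set" where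
  "V_nz = V_space - {\<lambda>X Y. 0}"

definition act :: "('n::finite) rmat \<Rightarrow> 'n product \<Rightarrow> 'n product" where
  "act g \<mu> = (\<lambda>X Y. g *v \<mu> (matrix_inv g *v X) (matrix_inv g *v Y))"

definition v_basis :: "('n::finite) \<Rightarrow> 'n \<Rightarrow> 'n \<Rightarrow> 'n product" where
  "v_basis i j k = (\<lambda>X Y. (X $ i * Y $ j - X $ j * Y $ i) *\<^sub>R axis k 1)"

definition struct_coeff :: "('n::finite) product \<Rightarrow> 'n \<Rightarrow> 'n \<Rightarrow> 'n \<Rightarrow> real" where
  "struct_coeff \<mu> i j k = \<mu> (axis i 1) (axis j 1) $ k"

text \<open>
  The usual topology of the finite-dimensional space \<^const>\<open>V_space\<close>: the one transported from a
  Euclidean space along the (injective, linear) coordinate map.  Listing the coefficients for all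
  \<open>i, j\<close> instead of \<open>i < j\<close> only repeats coordinates up to sign.
\<close>

definition V_topology :: "('n::finite) product topology" where
  "V_topology = pullback_topology V_space (\<lambda>\<mu>. \<chi> i j k. struct_coeff \<mu> i j k)
     (euclidean :: (real ^ 'n ^ 'n ^ 'n) topology)"

definition V_nz_topology :: "('n::finite) product topology" where
  "V_nz_topology = subtopology V_topology V_nz"


section \<open>Weights and stratifying vectors\<close>

definition E_mat :: "'n \<Rightarrow> 'n \<Rightarrow> ('n::finite) rmat" where
  "E_mat r s = axis r (axis s 1)"

definition diag_space :: "('n::finite) rmat set" where
  "diag_space = {A. \<forall>i j. i \<noteq> j \<longrightarrow> A $ i $ j = 0}"

definition alpha :: "'n \<Rightarrow> 'n \<Rightarrow> 'n \<Rightarrow> ('n::finite) rmat" where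
  "alpha i j k = E_mat k k - E_mat i i - E_mat j j"

text \<open>The library inner product (and hence norm) on matrices is the trace form.\<close>

lemma inner_eq_trace:
  fixes A B :: "('n::finite) rmat"
  shows "A \<bullet> B = trace (A ** transpose B)"
  by (simp add: inner_vec_def trace_def matrix_matrix_mult_def transpose_def)

definition weights :: "('n::{finite,linorder}) product \<Rightarrow> 'n rmat set" where
  "weights \<mu> = {alpha i j k | i j k. i < j \<and> struct_coeff \<mu> i j k \<noteq> 0}"

text \<open>Meaningful for \<open>\<mu> \<in> V_nz\<close> only; see \<open>beta_of_unique\<close> below.\<close>

definition beta_of :: "('n::{finite,linorder}) product \<Rightarrow> 'n rmat" where
  "beta_of \<mu> = (THE \<beta>. \<beta> \<in> convex hull (weights \<mu>) \<and>
      (\<forall>\<gamma> \<in> convex hull (weights \<mu>). norm \<beta> \<le> norm \<gamma>))"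

definition stratum :: "('n::{finite,linorder}) rmat \<Rightarrow> 'n product set" where
  "stratum \<beta> = {\<mu> \<in> V_nz.
      \<beta> \<in> {beta_of (act g \<mu>) | g. invertible g} \<and>
      (\<forall>\<gamma> \<in> {beta_of (act g \<mu>) | g. invertible g}. norm \<gamma> \<le> norm \<beta>)}"

definition W_set :: "('n::{finite,linorder}) rmat \<Rightarrow> 'n product set" where
  "W_set \<beta> = {\<mu> \<in> V_space. \<forall>i j k. i < j \<and> struct_coeff \<mu> i j k \<noteq> 0 \<longrightarrow>
      \<beta> \<bullet> alpha i j k \<ge> (norm \<beta>)\<^sup>2}"

definition weyl_chamber :: "('n::{finite,linorder}) rmat set" where
  "weyl_chamber = {A \<in> diag_space. \<forall>i j. i \<le> j \<longrightarrow> A $ i $ i \<le> A $ j $ j}"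

definition strata_index :: "('n::{finite,linorder}) rmat set" where
  "strata_index = {\<beta> \<in> weyl_chamber. stratum \<beta> \<noteq> {}}"


section \<open>Stratifications\<close>

text \<open>\<open>gt j i\<close> stands for \<open>j > i\<close>, a strict partial order on \<open>I\<close>.\<close>

definition stratification ::
    "'a topology \<Rightarrow> ('i \<Rightarrow> 'a set) \<Rightarrow> 'i set \<Rightarrow> ('i \<Rightarrow> 'i \<Rightarrow> bool) \<Rightarrow> bool" where
  "stratification X S I gt \<longleftrightarrow>
     finite I \<and>
     topspace X = (\<Union>i\<in>I. S i) \<and> disjoint_family_on S I \<and>
     irreflp_on I gt \<and> transp_on I gt \<and>
     (\<forall>i\<in>I. X closure_of (S i) \<subseteq> S i \<union> (\<Union>j\<in>{j\<in>I. gt j i}. S j))"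

definition locally_closed_in :: "'a topology \<Rightarrow> 'a set \<Rightarrow> bool" where
  "locally_closed_in X S \<longleftrightarrow> (\<exists>U C. openin X U \<and> closedin X C \<and> S = U \<inter> C)"


section \<open>Consistency of the definitions\<close>

lemma topspace_V_topology: "topspace (V_topology :: ('n::finite) product topology) = V_space"
  by (simp add: V_topology_def topspace_pullback_topology)

lemma topspace_V_nz_topology: "topspace (V_nz_topology :: ('n::finite) product topology) = V_nz"
  by (auto simp add: V_nz_topology_def topspace_V_topology V_nz_def)

lemma v_basis_in_V_space: "v_basis i j k \<in> V_space"
  unfolding V_space_def v_basis_def bilinear_def
  by (auto intro!: linearI simp: algebra_simps)

lemma v_basis_axis:
  assumes "i < (j :: 'n::{finite,linorder})"
  shows "v_basis i j k (axis i 1) (axis j 1) = axis k 1"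
    and "v_basis i j k (axis j 1) (axis i 1) = - axis k 1"
    and "{a, b} \<noteq> {i, j} \<Longrightarrow> v_basis i j k (axis a 1) (axis b 1) = 0"
  using assms by (auto simp: v_basis_def axis_def vec_eq_iff doubleton_eq_iff)

lemma struct_coeff_expansion:
  fixes \<mu> :: "('n::{finite,linorder}) product"
  assumes "\<mu> \<in> V_space"
  shows "\<mu> X Y = (\<Sum>(i, j)\<in>{(i, j). i < j}. \<Sum>k\<in>UNIV. struct_coeff \<mu> i j k *\<^sub>R v_basis i j k X Y)"
proof -
  have bil: "bilinear \<mu>" and skew: "\<And>X Y. \<mu> X Y = - \<mu> Y X"
    using assms unfolding V_space_def by blast+
  let ?t = "\<lambda>i j. (X $ i * Y $ j) *\<^sub>R \<mu> (axis i 1) (axis j 1)"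
  have diag: "\<mu> Z Z = 0" for Z
  proof -
    have "\<mu> Z Z + \<mu> Z Z = 0"
      using skew[of Z Z] by (metis eq_neg_iff_add_eq_0)
    then have "2 *\<^sub>R \<mu> Z Z = 0" by (metis scaleR_2)
    then show ?thesis by (metis scaleR_eq_0_iff zero_neq_numeral)
  qed
  have expand: "Z = (\<Sum>i\<in>UNIV. (Z $ i) *\<^sub>R axis i 1)" for Z :: "'n rvec"
    by (simp add: vec_eq_iff axis_def if_distrib cong: if_cong)
  have "\<mu> X Y = \<mu> (\<Sum>i\<in>UNIV. (X $ i) *\<^sub>R axis i 1) (\<Sum>i\<in>UNIV. (Y $ i) *\<^sub>R axis i 1)"
    by (rule arg_cong2[of _ _ _ _ \<mu>, OF expand expand])
  also have "\<dots> = (\<Sum>(i, j)\<in>UNIV. \<mu> ((X $ i) *\<^sub>R axis i 1) ((Y $ j) *\<^sub>R axis j 1))"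
    by (simp only: bilinear_sum[OF bil] UNIV_Times_UNIV)
  also have "\<dots> = (\<Sum>(i, j)\<in>UNIV. ?t i j)"
    using bil by (intro sum.cong) (auto simp: bilinear_lmul bilinear_rmul)
  also have "\<dots> = (\<Sum>(i, j)\<in>{(i, j). i < j} \<union> {(i, j). j < i}. ?t i j)"
  proof (rule sum.mono_neutral_right)
    show "\<forall>p\<in>UNIV - ({(i, j). i < j} \<union> {(i, j). j < i}). (case p of (i, j) \<Rightarrow> ?t i j) = 0"
    proof
      fix p :: "'n \<times> 'n"
      assume "p \<in> UNIV - ({(i, j). i < j} \<union> {(i, j). j < i})"
      then have "fst p = snd p" by (auto simp: case_prod_beta)
      then show "(case p of (i, j) \<Rightarrow> ?t i j) = 0" by (simp add: case_prod_beta diag)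
    qed
  qed simp_all
  also have "\<dots> = (\<Sum>(i, j)\<in>{(i, j). i < j}. ?t i j) + (\<Sum>(i, j)\<in>{(i, j). j < i}. ?t i j)"
    by (rule sum.union_disjoint) auto
  also have "(\<Sum>(i, j)\<in>{(i, j). j < i}. ?t i j) = (\<Sum>(i, j)\<in>{(i, j). i < j}. ?t j i)"
    by (rule sum.reindex_bij_witness[where i = prod.swap and j = prod.swap]) auto
  also have "(\<Sum>(i, j)\<in>{(i, j). i < j}. ?t i j) + (\<Sum>(i, j)\<in>{(i, j). i < j}. ?t j i)
      = (\<Sum>(i, j)\<in>{(i, j). i < j}. (X $ i * Y $ j - X $ j * Y $ i) *\<^sub>R \<mu> (axis i 1) (axis j 1))"
    unfolding sum.distrib[symmetric]
  proof (intro sum.cong refl, clarify)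
    fix i j :: 'n
    show "?t i j + ?t j i = (X $ i * Y $ j - X $ j * Y $ i) *\<^sub>R \<mu> (axis i 1) (axis j 1)"
      using skew[of "axis j 1" "axis i 1"] by (metis (no_types) diff_conv_add_uminus scaleR_left_diff_distrib scaleR_minus_right mult.commute)
  qed
  also have "\<dots> = (\<Sum>(i, j)\<in>{(i, j). i < j}. \<Sum>k\<in>UNIV. struct_coeff \<mu> i j k *\<^sub>R v_basis i j k X Y)"
  proof (intro sum.cong refl, clarify)
    fix i j :: 'n
    show "(X $ i * Y $ j - X $ j * Y $ i) *\<^sub>R \<mu> (axis i 1) (axis j 1)
        = (\<Sum>k\<in>UNIV. struct_coeff \<mu> i j k *\<^sub>R v_basis i j k X Y)"
      by (subst expand[of "\<mu> (axis i 1) (axis j 1)"])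
        (simp add: struct_coeff_def v_basis_def scaleR_sum_right mult.commute)
  qed
  finally show ?thesis .
qed

lemma beta_of_unique:
  assumes "\<mu> \<in> V_nz"
  shows "\<exists>!\<beta>. \<beta> \<in> convex hull (weights \<mu>) \<and> (\<forall>\<gamma> \<in> convex hull (weights \<mu>). norm \<beta> \<le> norm \<gamma>)"
proof -
  let ?C = "convex hull (weights \<mu>)"
  have "weights \<mu> \<subseteq> (\<lambda>(i, j, k). alpha i j k) ` UNIV"
    unfolding weights_def by (auto intro!: image_eqI[where x = "(_, _, _)"])
  then have "finite (weights \<mu>)"
    by (rule finite_subset) simp
  then have closed: "closed ?C"
    by (intro compact_imp_closed finite_imp_compact_convex_hull)
  have "weights \<mu> \<noteq> {}"
  proof
    assume e: "weights \<mu> = {}"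
    have "\<mu> X Y = 0" for X Y
    proof -
      have "struct_coeff \<mu> i j k = 0" if "i < j" for i j k
        using e that by (auto simp: weights_def)
      moreover have "\<mu> \<in> V_space" using assms by (simp add: V_nz_def)
      ultimately show ?thesis
        by (subst struct_coeff_expansion) (auto intro!: sum.neutral)
    qed
    then have "\<mu> = (\<lambda>X Y. 0)" by (intro ext)
    then show False using assms by (simp add: V_nz_def)
  qed
  then have ne: "?C \<noteq> {}" by simp
  have min: "closest_point ?C 0 \<in> ?C" "\<forall>\<gamma>\<in>?C. norm (closest_point ?C 0) \<le> norm \<gamma>"
    using closest_point_exists[OF closed ne, of 0] by auto
  show ?thesis
  proof (rule ex1I)
    show "closest_point ?C 0 \<in> ?C \<and> (\<forall>\<gamma>\<in>?C. norm (closest_point ?C 0) \<le> norm \<gamma>)"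
      using min by simp
    fix \<beta> assume "\<beta> \<in> ?C \<and> (\<forall>\<gamma>\<in>?C. norm \<beta> \<le> norm \<gamma>)"
    then show "\<beta> = closest_point ?C 0"
      by (intro closest_point_unique convex_convex_hull closed) auto
  qed
qed

end

(* W_set \<beta> is stable under lower triangular matrices when \<beta> lies in the chamber, and on it the minimal
   vectors have norm at least norm \<beta>, with equality only for \<beta> itself. Given this, GL(n) = B O(n)
   (Gram-Schmidt) moves a stratum into W_set \<beta> by orthogonal matrices; since O(n) is compact, the closure
   of a stratum stays in O(n).W_set \<beta>, where only \<beta> and longer vectors occur. Two labels of one stratum are
   compared by the Bruhat decomposition GL(n) = B W B: both are minimal vectors of one
   point up to the Weyl group, hence equal in the chamber. *)
theory Submission
  imports Defs
begin

section \<open>Triangular matrices\<close>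

text \<open>The obstacle is that \<open>beta_of\<close> refers to the fixed basis:
  \<open>weights (act g \<mu>)\<close> changes irregularly with g, so neither orbits nor limits can
  be followed through it directly. Membership in \<open>W_set \<beta>\<close> can: it says that
  certain coefficients vanish, a linear and hence closed condition. The link between the two is
  that, for nonzero \<mu>, \<open>beta_of \<mu>\<close> is the only \<beta> in the hull of the
  weights with \<mu> in \<open>W_set \<beta>\<close>. Membership in \<open>stratum \<beta>\<close>
  supplies the upper bound on norms that turns estimates on \<open>W_set \<beta>\<close> into
  equalities. The maximum over an orbit exists because finitely many weights leave finitely many
  minimal vectors. The triangular matrices are lower ones because the diagonal entries of a chamber
  element increase with the index. A label can be unique only inside the chamber, since permutation
  matrices already permute the maximal vectors of an orbit.\<close>

definition lower_triangular :: "('n::{finite,linorder}) rmat set" where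
  "lower_triangular = {L. (\<forall>i k. i < k \<longrightarrow> L $ i $ k = 0) \<and> (\<forall>i. L $ i $ i \<noteq> 0)}"

lemma lower_triangularD:
  assumes "L \<in> lower_triangular"
  shows "i < k \<Longrightarrow> L $ i $ k = 0" and "L $ i $ i \<noteq> 0"
  using assms by (auto simp: lower_triangular_def)

lemma finite_linorder_induct [case_names less]:
  fixes i :: "'n::{finite,linorder}"
  assumes "\<And>i. (\<And>k. k < i \<Longrightarrow> P k) \<Longrightarrow> P i"
  shows "P i"
proof (induction "card {..<i}" arbitrary: i rule: less_induct)
  case less
  show ?case
  proof (rule assms)
    fix k assume "k < i"
    then have "card {..<k} < card {..<i}"
      by (intro psubset_card_mono) auto
    then show "P k" by (rule less)
  qed
qed

text \<open>Entries of row i of A beyond the diagonal vanish, and so do the entries of column j of B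
  above row i; only k = i survives. B is restricted in one column only, so the rule applies in the
  middle of an induction that is still proving B triangular.\<close>

lemma lower_triangular_mult_entry:
  fixes A B :: "('n::{finite,linorder}) rmat"
  assumes A: "A \<in> lower_triangular" and B: "\<And>k. k < i \<Longrightarrow> B $ k $ j = 0"
  shows "(A ** B) $ i $ j = A $ i $ i * B $ i $ j"
proof -
  have "(A ** B) $ i $ j = (\<Sum>k\<in>UNIV. A $ i $ k * B $ k $ j)"
    by (simp add: matrix_matrix_mult_def)
  also have "\<dots> = (\<Sum>k\<in>{i}. A $ i $ k * B $ k $ j)"
    using lower_triangularD(1)[OF A, of i] B
    by (intro sum.mono_neutral_right) (auto simp: neq_iff)
  finally show ?thesis by simp
qed

lemma lower_triangular_mult:
  assumes "A \<in> lower_triangular" "B \<in> lower_triangular"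
  shows "A ** B \<in> lower_triangular"
proof -
  have "(A ** B) $ i $ j = A $ i $ i * B $ i $ j" if "i \<le> j" for i j
    by (rule lower_triangular_mult_entry) (use assms that in \<open>auto simp: lower_triangularD(1)\<close>)
  then show ?thesis
    using assms by (auto simp: lower_triangular_def)
qed

text \<open>Forward substitution shows that the kernel is trivial.\<close>

lemma lower_triangular_invertible:
  fixes L :: "('n::{finite,linorder}) rmat"
  assumes L: "L \<in> lower_triangular"
  shows "invertible L"
proof -
  have "x = 0" if x: "L *v x = 0" for x
  proof -
    have "x $ i = 0" for i
    proof (induction i rule: finite_linorder_induct)
      case (less i)
      have "0 = (L *v x) $ i" using x by simp
      also have "\<dots> = (\<Sum>k\<in>UNIV. L $ i $ k * x $ k)"
        by (simp add: matrix_vector_mult_def)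
      also have "\<dots> = (\<Sum>k\<in>{i}. L $ i $ k * x $ k)"
        using lower_triangularD(1)[OF L, of i] less
        by (intro sum.mono_neutral_right) (auto simp: neq_iff)
      finally show ?case using lower_triangularD(2)[OF L] by simp
    qed
    then show ?thesis by (simp add: vec_eq_iff)
  qed
  then show ?thesis
    by (metis invertible_left_inverse matrix_left_invertible_ker)
qed

lemma matrix_inv_mult:
  fixes A :: "real ^ 'n ^ 'n"
  assumes "invertible A"
  shows "A ** matrix_inv A = mat 1" and "matrix_inv A ** A = mat 1"
  using assms unfolding invertible_def matrix_inv_def by (metis (mono_tags, lifting) someI_ex)+

lemma matrix_inv_eq:
  fixes A :: "real ^ 'n ^ 'n"
  assumes "A ** B = mat 1"
  shows "matrix_inv A = B"
proof -
  have "invertible A"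
    using assms matrix_left_right_inverse by (auto simp: invertible_def)
  then have "matrix_inv A ** A ** B = B"
    by (simp add: matrix_inv_mult)
  with assms show ?thesis
    by (simp add: matrix_mul_assoc[symmetric])
qed

lemma invertible_matrix_inv: "invertible A \<Longrightarrow> invertible (matrix_inv (A :: real ^ 'n ^ 'n))"
  by (meson invertible_def matrix_inv_mult)

lemma matrix_inv_mat_1: "matrix_inv (mat 1 :: real ^ 'n ^ 'n) = mat 1"
  by (simp add: matrix_inv_eq)

lemma matrix_inv_mul:
  fixes A B :: "real ^ 'n ^ 'n"
  assumes "invertible A" "invertible B"
  shows "matrix_inv (A ** B) = matrix_inv B ** matrix_inv A"
  by (rule matrix_inv_eq) (metis assms matrix_inv_mult(1) matrix_mul_assoc matrix_mul_rid)

text \<open>Reading L M = 1 row by row from the top, each entry of M above the diagonal is forced to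
  be 0; the diagonal entries of L and M then multiply to 1.\<close>

lemma lower_triangular_matrix_inv:
  fixes L :: "('n::{finite,linorder}) rmat"
  assumes L: "L \<in> lower_triangular"
  shows "matrix_inv L \<in> lower_triangular"
proof -
  let ?M = "matrix_inv L"
  have LM: "L ** ?M = mat 1"
    using L lower_triangular_invertible matrix_inv_mult(1) by blast
  have M: "?M $ i $ j = 0" if "i < j" for i j
    using that
  proof (induction i rule: finite_linorder_induct)
    case (less i)
    have "(L ** ?M) $ i $ j = L $ i $ i * ?M $ i $ j"
      by (rule lower_triangular_mult_entry[OF L]) (use less in auto)
    moreover have "(L ** ?M) $ i $ j = 0"
      using less.prems by (simp add: LM mat_def)
    ultimately show ?case
      using lower_triangularD(2)[OF L] by simp
  qed
  have "?M $ i $ i \<noteq> 0" for i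
  proof -
    have "(L ** ?M) $ i $ i = L $ i $ i * ?M $ i $ i"
      by (rule lower_triangular_mult_entry[OF L]) (use M in auto)
    then show ?thesis by (simp add: LM mat_def) (metis mult_zero_right zero_neq_one)
  qed
  with M show ?thesis by (auto simp: lower_triangular_def)
qed

lemma mat_1_lower_triangular: "mat 1 \<in> lower_triangular"
  by (auto simp: lower_triangular_def mat_def)


section \<open>Triangular decompositions of invertible matrices\<close>

text \<open>As a left factor this is a row operation: row j becomes the combination of all rows with
  coefficients v. It is lower triangular when v vanishes beyond j and v j is nonzero.\<close>

definition row_combination :: "'n \<Rightarrow> ('n \<Rightarrow> real) \<Rightarrow> ('n::finite) rmat" where
  "row_combination j v = (\<chi> i k. if i = j then v k else if i = k then 1 else 0)"

lemma row_combination_mult: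
  "(row_combination j v ** A) $ i = (if i = j then (\<Sum>k\<in>UNIV. v k *\<^sub>R A $ k) else A $ i)"
  by (auto simp: row_combination_def matrix_matrix_mult_def vec_eq_iff if_distrib[of "\<lambda>x. x * _"]
      cong: if_cong)

lemma invertible_row_nonzero:
  fixes A :: "real ^ 'n ^ 'n"
  assumes "invertible A"
  shows "A $ i \<noteq> 0"
proof
  assume "A $ i = 0"
  then have "(A ** matrix_inv A) $ i $ i = 0"
    by (simp add: matrix_matrix_mult_def)
  with matrix_inv_mult(1)[OF assms] show False
    by (simp add: mat_def)
qed

lemma invertible_column_nonzero:
  fixes A :: "real ^ 'n ^ 'n"
  assumes "invertible A"
  shows "\<exists>i. A $ i $ j \<noteq> 0"
proof (rule ccontr)
  assume "\<not> ?thesis"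
  then have "(matrix_inv A ** A) $ j $ j = 0"
    by (simp add: matrix_matrix_mult_def)
  with matrix_inv_mult(2)[OF assms] show False
    by (simp add: mat_def)
qed

text \<open>Row j loses its projections onto the orthonormal rows in C and is normalised. All
  indices in C precede j, so this row operation is lower triangular.\<close>

lemma gram_schmidt_step:
  fixes h :: "('n::{finite,linorder}) rmat"
  assumes h: "invertible h" and C: "\<forall>c\<in>C. c < j"
    and on: "\<And>i k. i \<in> C \<Longrightarrow> k \<in> C \<Longrightarrow> h $ i \<bullet> h $ k = (if i = k then 1 else 0)"
  obtains a where "a \<in> lower_triangular"
    "\<And>i k. i \<in> insert j C \<Longrightarrow> k \<in> insert j C \<Longrightarrow> (a ** h) $ i \<bullet> (a ** h) $ k = (if i = k then 1 else 0)"
proof -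
  have jC: "j \<notin> C" using C by auto
  define v where "v k = (if k = j then 1 else if k \<in> C then - (h $ j \<bullet> h $ k) else 0)" for k
  define w where "w = (\<Sum>k\<in>UNIV. v k *\<^sub>R h $ k)"
  have low: "row_combination j (\<lambda>k. s * v k) \<in> lower_triangular" if "s \<noteq> 0" for s
    using that C by (auto simp: lower_triangular_def row_combination_def v_def)
  have w0: "w \<noteq> 0"
  proof -
    \<comment> \<open>Here w is row j of a product of invertible matrices, and no such row is
      zero.\<close>
    have "invertible (row_combination j v ** h)"
      using low[of 1] h by (simp add: invertible_mult lower_triangular_invertible)
    from invertible_row_nonzero[OF this, of j] show ?thesis
      by (simp add: row_combination_mult w_def)
  qed
  have w_eq: "w = h $ j + (\<Sum>k\<in>C. - (h $ j \<bullet> h $ k) *\<^sub>R h $ k)"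
  proof -
    have "w = (\<Sum>k\<in>insert j C. v k *\<^sub>R h $ k)"
      unfolding w_def by (rule sum.mono_neutral_right) (auto simp: v_def)
    also have "\<dots> = h $ j + (\<Sum>k\<in>C. v k *\<^sub>R h $ k)"
      using jC by (simp add: v_def)
    also have "(\<Sum>k\<in>C. v k *\<^sub>R h $ k) = (\<Sum>k\<in>C. - (h $ j \<bullet> h $ k) *\<^sub>R h $ k)"
      using jC by (intro sum.cong) (auto simp: v_def)
    finally show ?thesis .
  qed
  have orth: "w \<bullet> h $ c = 0" if "c \<in> C" for c
  proof -
    have "(\<Sum>k\<in>C. - (h $ j \<bullet> h $ k) *\<^sub>R h $ k) \<bullet> h $ c = (\<Sum>k\<in>C. if k = c then - (h $ j \<bullet> h $ c) else 0)"
      unfolding inner_sum_left using that by (intro sum.cong) (auto simp: on)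
    also have "\<dots> = - (h $ j \<bullet> h $ c)"
      using that by simp
    finally show ?thesis by (simp add: w_eq inner_add_left)
  qed
  define a where "a = row_combination j (\<lambda>k. inverse (norm w) * v k)"
  have ah: "(a ** h) $ i = (if i = j then inverse (norm w) *\<^sub>R w else h $ i)" for i
    by (simp add: a_def row_combination_mult w_def scaleR_sum_right)
  have unit: "(a ** h) $ j \<bullet> (a ** h) $ j = 1"
    using w0 by (simp add: ah dot_square_norm power2_eq_square)
  have orth': "(a ** h) $ j \<bullet> h $ c = 0" if "c \<in> C" for c
    using orth[OF that] by (simp add: ah)
  have ahC: "(a ** h) $ c = h $ c" if "c \<in> C" for c
    using that jC by (auto simp: ah)
  have "(a ** h) $ i \<bullet> (a ** h) $ k = (if i = k then 1 else 0)"
    if "i \<in> insert j C" "k \<in> insert j C" for i k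
  proof (cases "i = j"; cases "k = j")
    assume "i = j" "k = j"
    then show ?thesis by (simp add: unit)
  next
    assume "i = j" "k \<noteq> j"
    then show ?thesis using that orth' by (simp add: ahC)
  next
    assume "i \<noteq> j" "k = j"
    then show ?thesis using that orth'[of i] by (simp add: ahC inner_commute[of "h $ i"])
  next
    assume "i \<noteq> j" "k \<noteq> j"
    then show ?thesis using that by (simp add: ahC on)
  qed
  moreover have "a \<in> lower_triangular"
    unfolding a_def using low w0 by simp
  ultimately show ?thesis using that by blast
qed

lemma lower_triangular_orthogonal_decomposition:
  fixes g :: "('n::{finite,linorder}) rmat"
  assumes g: "invertible g"
  obtains a where "a \<in> lower_triangular" "orthogonal_matrix (a ** g)"
proof -
  have "\<exists>a\<in>lower_triangular. \<forall>i\<in>C. \<forall>k\<in>C. (a ** g) $ i \<bullet> (a ** g) $ k = (if i = k then 1 else 0)"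
    if "finite C" for C
    using that
  \<comment> \<open>Rows join C in increasing order, which is what keeps the accumulated left factor
    lower triangular.\<close>
  proof (induction C rule: finite_linorder_max_induct)
    case empty
    show ?case using mat_1_lower_triangular by blast
  next
    case (insert j C)
    then obtain a where a: "a \<in> lower_triangular"
      and on: "\<And>i k. i \<in> C \<Longrightarrow> k \<in> C \<Longrightarrow> (a ** g) $ i \<bullet> (a ** g) $ k = (if i = k then 1 else 0)"
      by blast
    have "invertible (a ** g)" using a g by (simp add: invertible_mult lower_triangular_invertible)
    from gram_schmidt_step[OF this insert.hyps(2) on] obtain b where "b \<in> lower_triangular"
      "\<And>i k. i \<in> insert j C \<Longrightarrow> k \<in> insert j C
        \<Longrightarrow> (b ** (a ** g)) $ i \<bullet> (b ** (a ** g)) $ k = (if i = k then 1 else 0)"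
      by blast
    moreover from this have "b ** a \<in> lower_triangular"
      using a by (simp add: lower_triangular_mult)
    ultimately show ?case
      by (intro bexI[of _ "b ** a"]) (simp_all add: matrix_mul_assoc[symmetric])
  qed
  from this[of UNIV] obtain a where a: "a \<in> lower_triangular"
    and on: "\<And>i k. (a ** g) $ i \<bullet> (a ** g) $ k = (if i = k then 1 else 0)"
    by auto
  have "(a ** g) ** transpose (a ** g) = mat 1"
    using on by (simp add: matrix_matrix_mult_def transpose_def mat_def inner_vec_def vec_eq_iff)
  then show ?thesis
    using that a by (metis matrix_left_right_inverse orthogonal_matrix)
qed

text \<open>Columns are cleared from right to left. Row operations with a pivot row clear column j
  below the pivot, and column operations clear the pivot row to the left of j; both are lower
  triangular. The condition that pivot rows vanish to the left of their pivots keeps finished rows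
  and columns intact when further columns are treated.\<close>

lemma elimination_step:
  fixes h :: "('n::{finite,linorder}) rmat"
  assumes h: "invertible h" and C: "\<forall>c\<in>C. j < c"
    and mon: "\<And>i c. c \<in> C \<Longrightarrow> h $ i $ c \<noteq> 0 \<longleftrightarrow> i = s c"
    and left: "\<And>c l. c \<in> C \<Longrightarrow> l < c \<Longrightarrow> h $ s c $ l = 0"
  obtains a b s' where "a \<in> lower_triangular" "b \<in> lower_triangular"
    "\<And>i c. c \<in> insert j C \<Longrightarrow> (a ** h ** b) $ i $ c \<noteq> 0 \<longleftrightarrow> i = s' c"
    "\<And>c l. c \<in> insert j C \<Longrightarrow> l < c \<Longrightarrow> (a ** h ** b) $ s' c $ l = 0"
proof -
  \<comment> \<open>The pivot is the topmost nonzero entry of column j: only rows below it remain to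
    be cleared, and lower triangular row operations reach exactly those.\<close>
  define r where "r = Min {i. h $ i $ j \<noteq> 0}"
  have ne: "{i. h $ i $ j \<noteq> 0} \<noteq> {}"
    using invertible_column_nonzero[OF h] by auto
  have r: "h $ r $ j \<noteq> 0"
    using Min_in[OF _ ne] by (simp add: r_def)
  have top: "h $ i $ j = 0" if "i < r" for i
    using that Min_le[of "{i. h $ i $ j \<noteq> 0}" i] by (fastforce simp: r_def)
  \<comment> \<open>An old pivot row has a zero in column j, because j lies to the left of its
    pivot; the new pivot therefore sits in a fresh row.\<close>
  have rs: "r \<noteq> s c" if "c \<in> C" for c
    using r left[OF that, of j] C that by auto
  define p where "p i = (if r < i then h $ i $ j / h $ r $ j else 0)" for i
  define q where "q l = (if l < j then h $ r $ l / h $ r $ j else 0)" for l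
  define a :: "'n rmat" where "a = (\<chi> i k. (if k = i then 1 else 0) - (if k = r then p i else 0))"
  define b :: "'n rmat" where "b = (\<chi> k l. (if k = l then 1 else 0) - (if k = j then q l else 0))"
  have a: "a \<in> lower_triangular" and b: "b \<in> lower_triangular"
    by (auto simp: a_def b_def p_def q_def lower_triangular_def)
  have ah: "(a ** h) $ i $ l = h $ i $ l - p i * h $ r $ l" for i l
    by (simp add: a_def matrix_matrix_mult_def left_diff_distrib sum_subtractf if_distrib[of "\<lambda>x. x * _"]
      cong: if_cong)
  have mb: "(m ** b) $ i $ l = m $ i $ l - m $ i $ j * q l" for i l and m :: "'n rmat"
    by (simp add: b_def matrix_matrix_mult_def right_diff_distrib sum_subtractf if_distrib[of "\<lambda>x. _ * x"]
      cong: if_cong)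
  have E: "(a ** h ** b) $ i $ l = (h $ i $ l - p i * h $ r $ l) - (h $ i $ j - p i * h $ r $ j) * q l" for i l
    by (simp add: mb ah)
  have col: "h $ i $ j - p i * h $ r $ j = (if i = r then h $ r $ j else 0)" for i
    using r top[of i] by (cases i r rule: linorder_cases) (auto simp: p_def)
  have pr: "p r = 0" by (simp add: p_def)
  \<comment> \<open>The same zeros mean that the row operation leaves the old pivot rows
    unchanged.\<close>
  have ps: "p (s c) = 0" if "c \<in> C" for c
    using left[OF that, of j] C that by (simp add: p_def)
  define s' where "s' = s(j := r)"
  have jC: "j \<notin> C" using C by auto
  have "(a ** h ** b) $ i $ c \<noteq> 0 \<longleftrightarrow> i = s' c" if "c \<in> insert j C" for i c
  proof (cases "c = j")
    case True
    then show ?thesis by (simp add: E col s'_def q_def r)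
  next
    case False
    then have c: "c \<in> C" using that by simp
    have "h $ r $ c = 0" using mon[OF c, of r] rs[OF c] by blast
    moreover have "q c = 0" using C c by (auto simp: q_def)
    ultimately show ?thesis using False mon[OF c] by (simp add: E s'_def)
  qed
  moreover have "(a ** h ** b) $ s' c $ l = 0" if "c \<in> insert j C" "l < c" for c l
  proof (cases "c = j")
    case True
    then show ?thesis using that r by (simp add: E s'_def col pr q_def)
  next
    case False
    then have c: "c \<in> C" using that by simp
    have "j < c" using C c by simp
    then show ?thesis
      using False left[OF c] that by (simp add: E s'_def ps[OF c])
  qed
  ultimately show ?thesis using that a b by blast
qed

lemma lower_triangular_monomial_decomposition:
  fixes g :: "('n::{finite,linorder}) rmat"
  assumes g: "invertible g"
  obtains a b s where "a \<in> lower_triangular" "b \<in> lower_triangular" "bij s"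
    "\<And>i j. (a ** g ** b) $ i $ j \<noteq> 0 \<longleftrightarrow> i = s j"
proof -
  have "\<exists>a b s. a \<in> lower_triangular \<and> b \<in> lower_triangular \<and>
      (\<forall>c\<in>C. \<forall>i. (a ** g ** b) $ i $ c \<noteq> 0 \<longleftrightarrow> i = s c) \<and>
      (\<forall>c\<in>C. \<forall>l<c. (a ** g ** b) $ s c $ l = 0)"
    if "finite C" for C
    using that
  proof (induction C rule: finite_linorder_min_induct)
    case empty
    show ?case using mat_1_lower_triangular by blast
  next
    case (insert j C)
    then obtain a b s where ab: "a \<in> lower_triangular" "b \<in> lower_triangular"
      and mon: "\<And>i c. c \<in> C \<Longrightarrow> (a ** g ** b) $ i $ c \<noteq> 0 \<longleftrightarrow> i = s c"
      and left: "\<And>c l. c \<in> C \<Longrightarrow> l < c \<Longrightarrow> (a ** g ** b) $ s c $ l = 0"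
      by blast
    have "invertible (a ** g ** b)"
      using ab g by (simp add: invertible_mult lower_triangular_invertible)
    from elimination_step[OF this insert.hyps(2) mon left]
    obtain a' b' s' where *: "a' \<in> lower_triangular" "b' \<in> lower_triangular"
      "\<And>i c. c \<in> insert j C \<Longrightarrow> (a' ** (a ** g ** b) ** b') $ i $ c \<noteq> 0 \<longleftrightarrow> i = s' c"
      "\<And>c l. c \<in> insert j C \<Longrightarrow> l < c \<Longrightarrow> (a' ** (a ** g ** b) ** b') $ s' c $ l = 0"
      by blast
    have "a' ** (a ** g ** b) ** b' = (a' ** a) ** g ** (b ** b')"
      by (simp add: matrix_mul_assoc)
    with * lower_triangular_mult[OF *(1) ab(1)] lower_triangular_mult[OF ab(2) *(2)] show ?case
      by (intro exI[of _ "a' ** a"] exI[of _ "b ** b'"] exI[of _ s']) simp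
  qed
  from this[of UNIV] obtain a b s where ab: "a \<in> lower_triangular" "b \<in> lower_triangular"
      and mon: "\<And>i c. (a ** g ** b) $ i $ c \<noteq> 0 \<longleftrightarrow> i = s c"
    by auto
  have inv: "invertible (a ** g ** b)"
    using ab g by (simp add: invertible_mult lower_triangular_invertible)
  \<comment> \<open>A row without a pivot would be a zero row of an invertible matrix.\<close>
  have "surj s"
  proof -
    have "i \<in> range s" for i
      using invertible_row_nonzero[OF inv, of i] mon[of i] by (auto simp: vec_eq_iff)
    then show ?thesis by auto
  qed
  then have "bij s"
    by (simp add: bij_def finite_UNIV_surj_inj)
  then show ?thesis using that ab mon by blast
qed


section \<open>The action in coordinates\<close>

lemma V_spaceD:
  assumes "\<mu> \<in> V_space"
  shows "bilinear \<mu>" and "\<mu> X Y = - \<mu> Y X"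
  using assms unfolding V_space_def by blast+

lemma struct_coeff_swap: "\<mu> \<in> V_space \<Longrightarrow> struct_coeff \<mu> i j k = - struct_coeff \<mu> j i k"
  unfolding struct_coeff_def by (subst V_spaceD(2)) simp_all

lemma act_in_V_space:
  assumes "\<mu> \<in> V_space"
  shows "act g \<mu> \<in> V_space"
proof -
  note bil = V_spaceD(1)[OF assms, unfolded bilinear_def]
  have "bilinear (act g \<mu>)"
    unfolding bilinear_def act_def using bil
    by (auto intro!: linear_compose[OF _ matrix_vector_mul_linear, unfolded o_def]
        linear_compose[OF matrix_vector_mul_linear, unfolded o_def])
  moreover have "act g \<mu> X Y = - act g \<mu> Y X" for X Y
    unfolding act_def
    by (subst V_spaceD(2)[OF assms]) (simp add: linear_neg[OF matrix_vector_mul_linear])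
  ultimately show ?thesis unfolding V_space_def by blast
qed

lemma act_mat_1: "act (mat 1) \<mu> = \<mu>"
  by (simp add: act_def matrix_inv_mat_1)

lemma act_mult:
  assumes "invertible g" "invertible h"
  shows "act (g ** h) \<mu> = act g (act h \<mu>)"
  by (simp add: act_def matrix_inv_mul[OF assms] matrix_vector_mul_assoc)

lemma act_matrix_inv:
  assumes "invertible g"
  shows "act (matrix_inv g) (act g \<mu>) = \<mu>" and "act g (act (matrix_inv g) \<mu>) = \<mu>"
  using assms by (simp_all add: act_mult[symmetric] invertible_matrix_inv matrix_inv_mult act_mat_1)

lemma act_in_V_nz:
  assumes "\<mu> \<in> V_nz" "invertible g"
  shows "act g \<mu> \<in> V_nz"
proof -
  have "act g \<mu> \<noteq> (\<lambda>X Y. 0)"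
  proof
    assume "act g \<mu> = (\<lambda>X Y. 0)"
    then have "\<mu> = act (matrix_inv g) (\<lambda>X Y. 0)"
      using act_matrix_inv(1)[OF assms(2)] by metis
    also have "\<dots> = (\<lambda>X Y. 0)"
      by (simp add: act_def)
    finally show False using assms(1) by (simp add: V_nz_def)
  qed
  then show ?thesis using assms(1) by (simp add: V_nz_def act_in_V_space)
qed

text \<open>The action on structure constants, with h in the role of the inverse of g. As an
  independent argument it makes the expression polynomial in g, h and t, hence continuous; for
  orthogonal g the transpose can be inserted.\<close>

definition tensor_act :: "'n rmat \<Rightarrow> 'n rmat \<Rightarrow> (real, 'n) vec ^ 'n ^ 'n \<Rightarrow> (real, 'n::finite) vec ^ 'n ^ 'n" where
  "tensor_act g h t = (\<chi> i j k. \<Sum>c\<in>UNIV. \<Sum>a\<in>UNIV. \<Sum>b\<in>UNIV.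
      g $ k $ c * h $ a $ i * h $ b $ j * t $ a $ b $ c)"

lemma matrix_vector_mult_axis:
  fixes h :: "real ^ 'n ^ 'n"
  shows "h *v axis i 1 = (\<Sum>a\<in>UNIV. h $ a $ i *\<^sub>R axis a 1)"
  by (simp add: vec_eq_iff matrix_vector_mult_def axis_def if_distrib cong: if_cong)

lemma struct_coeff_act:
  assumes "\<mu> \<in> V_space"
  shows "struct_coeff (act g \<mu>) i j k =
    tensor_act g (matrix_inv g) (\<chi> i j k. struct_coeff \<mu> i j k) $ i $ j $ k"
proof -
  let ?h = "matrix_inv g"
  note bil = V_spaceD(1)[OF assms]
  have "\<mu> (?h *v axis i 1) (?h *v axis j 1)
      = (\<Sum>(a, b)\<in>UNIV \<times> UNIV. \<mu> (?h $ a $ i *\<^sub>R axis a 1) (?h $ b $ j *\<^sub>R axis b 1))"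
    by (simp only: matrix_vector_mult_axis bilinear_sum[OF bil])
  also have "\<dots> = (\<Sum>(a, b)\<in>UNIV \<times> UNIV. (?h $ a $ i * ?h $ b $ j) *\<^sub>R \<mu> (axis a 1) (axis b 1))"
    using bil by (intro sum.cong) (auto simp: bilinear_lmul bilinear_rmul)
  also have "\<dots> = (\<Sum>a\<in>UNIV. \<Sum>b\<in>UNIV. (?h $ a $ i * ?h $ b $ j) *\<^sub>R \<mu> (axis a 1) (axis b 1))"
    by (simp only: sum.cartesian_product)
  finally show ?thesis
    by (simp add: struct_coeff_def act_def tensor_act_def matrix_vector_mult_def sum_distrib_left
        mult.assoc)
qed


section \<open>Vectors of minimal norm\<close>

text \<open>Swapping i and j fixes \<open>alpha i j k\<close> and only changes the sign of the
  coefficient. Dropping i < j matters because permutations of the basis do not respect the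
  order.\<close>

lemma weights_eq:
  assumes "\<mu> \<in> V_space"
  shows "weights \<mu> = {alpha i j k | i j k. struct_coeff \<mu> i j k \<noteq> 0}"
proof -
  have "\<exists>i' j'. alpha i j k = alpha i' j' k \<and> i' < j' \<and> struct_coeff \<mu> i' j' k \<noteq> 0"
    if nz: "struct_coeff \<mu> i j k \<noteq> 0" for i j k
  proof (cases i j rule: linorder_cases)
    case greater
    moreover have "alpha i j k = alpha j i k" by (simp add: alpha_def)
    ultimately show ?thesis using nz struct_coeff_swap[OF assms, of i j k] by fastforce
  next
    case equal
    then show ?thesis using nz struct_coeff_swap[OF assms, of i j k] by simp
  qed (use nz in blast)
  then show ?thesis unfolding weights_def by blast
qed

lemma finite_alpha: "finite {alpha i j k | i j k :: 'n::{finite,linorder}. True}"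
proof -
  have "{alpha i j k | i j k :: 'n. True} \<subseteq> (\<lambda>(i, j, k). alpha i j k) ` UNIV"
    by (auto intro!: image_eqI[where x = "(_, _, _)"])
  then show ?thesis by (rule finite_subset) simp
qed

lemma weights_subset: "weights \<mu> \<subseteq> {alpha i j k | i j k. True}"
  by (auto simp: weights_def)

lemma W_set_iff:
  "\<mu> \<in> W_set \<beta> \<longleftrightarrow> \<mu> \<in> V_space \<and> (\<forall>\<alpha>\<in>weights \<mu>. (norm \<beta>)\<^sup>2 \<le> \<beta> \<bullet> \<alpha>)"
  by (auto simp: W_set_def weights_def)

lemma W_set_iff_struct_coeff:
  "\<mu> \<in> W_set \<beta> \<longleftrightarrow> \<mu> \<in> V_space \<and>
    (\<forall>i j k. struct_coeff \<mu> i j k \<noteq> 0 \<longrightarrow> (norm \<beta>)\<^sup>2 \<le> \<beta> \<bullet> alpha i j k)"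
  using weights_eq[of \<mu>] by (auto simp: W_set_iff)

lemma beta_of_minimal:
  assumes "\<mu> \<in> V_nz"
  shows "beta_of \<mu> \<in> convex hull (weights \<mu>)"
    and "\<gamma> \<in> convex hull (weights \<mu>) \<Longrightarrow> norm (beta_of \<mu>) \<le> norm \<gamma>"
  using theI'[OF beta_of_unique[OF assms]] unfolding beta_of_def by blast+

text \<open>The obtuse angle criterion for the point of a closed convex set nearest to 0.\<close>

lemma in_W_set_beta_of:
  assumes "\<mu> \<in> V_nz"
  shows "\<mu> \<in> W_set (beta_of \<mu>)"
proof -
  have "finite (weights \<mu>)"
    using finite_subset[OF weights_subset finite_alpha] .
  then have closed: "closed (convex hull (weights \<mu>))"
    by (intro compact_imp_closed finite_imp_compact_convex_hull)
  have "(norm (beta_of \<mu>))\<^sup>2 \<le> beta_of \<mu> \<bullet> \<alpha>" if "\<alpha> \<in> weights \<mu>" for \<alpha>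
  proof -
    have "(0 - beta_of \<mu>) \<bullet> (\<alpha> - beta_of \<mu>) \<le> 0"
      using any_closest_point_dot[OF convex_convex_hull closed, of "beta_of \<mu>" \<alpha> 0]
        beta_of_minimal[OF assms] hull_inc[OF that] by simp
    then show ?thesis
      by (simp add: inner_diff_right power2_norm_eq_inner)
  qed
  then show ?thesis using assms by (simp add: W_set_iff V_nz_def)
qed

text \<open>The half-space of all x with
  \<open>\<beta> \<bullet> x \<ge> (norm \<beta>)\<^sup>2\<close> contains the weights, hence their
  hull, and \<beta> is its unique point nearest to 0.\<close>

lemma W_set_norm_le:
  assumes nz: "\<mu> \<in> V_nz" and W: "\<mu> \<in> W_set \<beta>"
  shows "norm \<beta> \<le> norm (beta_of \<mu>)"
    and "norm (beta_of \<mu>) \<le> norm \<beta> \<Longrightarrow> beta_of \<mu> = \<beta>"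
proof -
  have "convex hull (weights \<mu>) \<subseteq> {x. \<beta> \<bullet> x \<ge> (norm \<beta>)\<^sup>2}"
    using W by (intro hull_minimal) (auto simp: W_set_iff convex_halfspace_ge)
  then have ge: "(norm \<beta>)\<^sup>2 \<le> \<beta> \<bullet> beta_of \<mu>"
    using beta_of_minimal(1)[OF nz] by blast
  also have "\<dots> \<le> norm \<beta> * norm (beta_of \<mu>)"
    by (rule norm_cauchy_schwarz)
  finally show "norm \<beta> \<le> norm (beta_of \<mu>)"
    by (cases "\<beta> = 0") (simp_all add: power2_eq_square)
  assume le: "norm (beta_of \<mu>) \<le> norm \<beta>"
  have "(norm (beta_of \<mu> - \<beta>))\<^sup>2 = (norm (beta_of \<mu>))\<^sup>2 - 2 * (\<beta> \<bullet> beta_of \<mu>) + (norm \<beta>)\<^sup>2"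
    by (simp add: power2_norm_eq_inner inner_diff inner_commute)
  also have "\<dots> \<le> 0"
    using ge power_mono[OF le norm_ge_zero, of 2] by linarith
  finally show "beta_of \<mu> = \<beta>" by simp
qed

text \<open>Lying in the hull bounds the minimal norm by that of \<beta>, which is the equality case
  of the half-space estimate.\<close>

lemma beta_of_eqI:
  assumes nz: "\<mu> \<in> V_nz" and hull: "\<beta> \<in> convex hull (weights \<mu>)" and W: "\<mu> \<in> W_set \<beta>"
  shows "beta_of \<mu> = \<beta>"
  using W_set_norm_le(2)[OF nz W] beta_of_minimal(2)[OF nz hull] by blast

text \<open>The value depends only on \<open>weights \<mu>\<close>, a subset of a finite set. This
  covers every \<mu>, even where the description denotes an unspecified matrix.\<close>

lemma finite_range_beta_of: "finite (range (beta_of :: ('n::{finite,linorder}) product \<Rightarrow> 'n rmat))"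
proof -
  let ?f = "\<lambda>A :: 'n rmat set. THE \<beta>. \<beta> \<in> convex hull A \<and> (\<forall>\<gamma> \<in> convex hull A. norm \<beta> \<le> norm \<gamma>)"
  have "range beta_of \<subseteq> ?f ` Pow {alpha i j k | i j k :: 'n. True}"
  proof
    fix \<beta> :: "'n rmat" assume "\<beta> \<in> range beta_of"
    then obtain \<mu> where "\<beta> = ?f (weights \<mu>)" by (auto simp: beta_of_def)
    then show "\<beta> \<in> ?f ` Pow {alpha i j k | i j k :: 'n. True}"
      using weights_subset[of \<mu>] by blast
  qed
  then show ?thesis using finite_alpha by (rule finite_subset[OF _ finite_imageI[OF finite_Pow_iff[THEN iffD2]]])
qed

lemma alpha_nth:
  "alpha i j k $ r $ s = (if r = s then (if r = k then 1 else 0) - (if r = i then 1 else 0)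
      - (if r = j then 1 else 0) else 0)"
  by (auto simp: alpha_def E_mat_def axis_def)

lemma beta_of_in_diag_space:
  assumes "\<mu> \<in> V_nz"
  shows "beta_of \<mu> \<in> diag_space"
proof -
  have "convex hull (weights \<mu>) \<subseteq> diag_space"
    by (intro hull_minimal) (auto simp: weights_def diag_space_def alpha_nth convex_def)
  then show ?thesis using beta_of_minimal(1)[OF assms] by blast
qed

lemma inner_alpha: "\<beta> \<bullet> alpha i j k = \<beta> $ k $ k - \<beta> $ i $ i - \<beta> $ j $ j"
  by (simp add: alpha_def E_mat_def inner_diff_right inner_axis)

text \<open>Lower triangular matrices raise the weights of the one-parameter group generated by a diagonal
  matrix with increasing entries, so they act on the sum of its high weight spaces.\<close>

lemma lower_triangular_act_W_set:
  assumes b: "b \<in> lower_triangular" and \<beta>: "\<beta> \<in> weyl_chamber" and \<mu>: "\<mu> \<in> W_set \<beta>"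
  shows "act b \<mu> \<in> W_set \<beta>"
proof -
  have V: "\<mu> \<in> V_space" using \<mu> by (simp add: W_set_iff)
  let ?h = "matrix_inv b"
  have h: "?h \<in> lower_triangular" using b by (rule lower_triangular_matrix_inv)
  have "(norm \<beta>)\<^sup>2 \<le> \<beta> \<bullet> alpha i j k" if nz: "struct_coeff (act b \<mu>) i j k \<noteq> 0" for i j k
  proof -
    have "\<exists>c a d. b $ k $ c * ?h $ a $ i * ?h $ d $ j * struct_coeff \<mu> a d c \<noteq> 0"
    proof (rule ccontr)
      assume "\<not> ?thesis"
      then have "tensor_act b ?h (\<chi> i j k. struct_coeff \<mu> i j k) $ i $ j $ k = 0"
        unfolding tensor_act_def vec_lambda_beta by (intro sum.neutral ballI) blast
      then have "struct_coeff (act b \<mu>) i j k = 0"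
        by (simp only: struct_coeff_act[OF V])
      with nz show False by contradiction
    qed
    then obtain c a d where "b $ k $ c \<noteq> 0" "?h $ a $ i \<noteq> 0" "?h $ d $ j \<noteq> 0"
      and \<mu>acd: "struct_coeff \<mu> a d c \<noteq> 0"
      by auto
    \<comment> \<open>Passing from (a, d, c) to (i, j, k) can only raise the output index and lower
      the input indices, so the pairing with an increasing diagonal cannot decrease.\<close>
    then have "c \<le> k" "i \<le> a" "j \<le> d"
      using lower_triangularD(1)[OF b] lower_triangularD(1)[OF h] by (meson not_le)+
    then have "\<beta> $ c $ c \<le> \<beta> $ k $ k" "\<beta> $ i $ i \<le> \<beta> $ a $ a" "\<beta> $ j $ j \<le> \<beta> $ d $ d"
      using \<beta> by (auto simp: weyl_chamber_def)
    moreover have "(norm \<beta>)\<^sup>2 \<le> \<beta> \<bullet> alpha a d c"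
      using \<mu> \<mu>acd by (auto simp: W_set_iff_struct_coeff)
    ultimately show ?thesis by (simp add: inner_alpha)
  qed
  then show ?thesis using V by (simp add: W_set_iff_struct_coeff act_in_V_space)
qed


section \<open>Monomial matrices and the Weyl group\<close>

text \<open>Conjugation by the permutation matrix of s, for bijective s. The inverse appears so that
  position (i, j) moves to (s i, s j).\<close>

definition relabel :: "('n \<Rightarrow> 'n) \<Rightarrow> 'n rmat \<Rightarrow> ('n::finite) rmat" where
  "relabel s A = (\<chi> i j. A $ inv s i $ inv s j)"

lemma relabel_nth: "bij s \<Longrightarrow> relabel s A $ s i $ s j = A $ i $ j"
  by (simp add: relabel_def bij_is_inj)

lemma linear_relabel: "linear (relabel s)"
  by (rule linearI) (simp_all add: relabel_def vec_eq_iff)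

lemma inner_relabel:
  assumes "bij s"
  shows "relabel s A \<bullet> relabel s B = A \<bullet> B"
proof -
  have "relabel s A \<bullet> relabel s B = (\<Sum>i\<in>UNIV. \<Sum>j\<in>UNIV. A $ inv s i $ inv s j * B $ inv s i $ inv s j)"
    by (simp add: relabel_def inner_vec_def)
  also have "\<dots> = (\<Sum>i\<in>UNIV. \<Sum>j\<in>UNIV. A $ inv s i $ j * B $ inv s i $ j)"
    by (intro sum.cong refl sum.reindex_bij_betw bij_imp_bij_inv assms)
  also have "\<dots> = (\<Sum>i\<in>UNIV. \<Sum>j\<in>UNIV. A $ i $ j * B $ i $ j)"
    by (rule sum.reindex_bij_betw[OF bij_imp_bij_inv[OF assms]])
  finally show ?thesis by (simp add: inner_vec_def)
qed

lemma norm_relabel: "bij s \<Longrightarrow> norm (relabel s A) = norm A"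
  by (simp add: norm_eq_sqrt_inner inner_relabel)

lemma relabel_alpha:
  assumes "bij s"
  shows "relabel s (alpha i j k) = alpha (s i) (s j) (s k)"
proof -
  have "alpha i j k $ inv s (s r) $ inv s (s t) = alpha (s i) (s j) (s k) $ s r $ s t" for r t
    using bij_is_inj[OF assms] by (simp add: alpha_nth inj_eq)
  then have "relabel s (alpha i j k) $ r $ t = alpha (s i) (s j) (s k) $ r $ t" for r t
    using surj_f_inv_f[OF bij_is_surj[OF assms]] by (metis relabel_nth[OF assms] bij_is_inj[OF assms] inv_f_f)
  then show ?thesis by (simp add: vec_eq_iff)
qed

text \<open>A permutation matrix with arbitrary nonzero entries in place of the ones, that is, an
  element of the normaliser of the diagonal torus. The torus part merely rescales coefficients, so
  weights feel only s.\<close>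

locale monomial =
  fixes m :: "('n::{finite,linorder}) rmat" and s :: "'n \<Rightarrow> 'n"
  assumes bij: "bij s" and nonzero_iff: "\<And>i j. m $ i $ j \<noteq> 0 \<longleftrightarrow> i = s j"
begin

lemma mult_inverse: "m ** (\<chi> j i. if i = s j then 1 / m $ i $ j else 0) = mat 1"
proof -
  have "(\<Sum>k\<in>UNIV. m $ i $ k * (if l = s k then 1 / m $ l $ k else 0)) = (if i = l then 1 else 0)" for i l
  proof -
    obtain k0 where l: "l = s k0" using bij by (metis bij_pointE)
    have "(\<Sum>k\<in>UNIV. m $ i $ k * (if l = s k then 1 / m $ l $ k else 0))
        = (\<Sum>k\<in>UNIV. if k = k0 then m $ i $ k0 / m $ l $ k0 else 0)"
      using bij_is_inj[OF bij] by (intro sum.cong) (auto simp: l dest: injD)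
    also have "\<dots> = m $ i $ k0 / m $ l $ k0" by simp
    also have "\<dots> = (if i = l then 1 else 0)"
      using nonzero_iff[of l k0] nonzero_iff[of i k0] l by auto
    finally show ?thesis .
  qed
  then show ?thesis
    by (simp add: matrix_matrix_mult_def mat_def vec_eq_iff)
qed

lemma invertible: "invertible m"
  using mult_inverse matrix_left_right_inverse unfolding invertible_def by blast

text \<open>Each basis vector with index i goes to a nonzero multiple of the one with index s i, so
  the coefficient is only multiplied by a nonzero scalar.\<close>

lemma struct_coeff_act_nonzero_iff:
  assumes "\<mu> \<in> V_space"
  shows "struct_coeff (act m \<mu>) (s i) (s j) (s k) \<noteq> 0 \<longleftrightarrow> struct_coeff \<mu> i j k \<noteq> 0"
proof -
  note bil = V_spaceD(1)[OF assms]
  have ax: "matrix_inv m *v axis (s i) 1 = (1 / m $ s i $ i) *\<^sub>R axis i 1" for i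
    using bij_is_inj[OF bij]
    by (auto simp: matrix_inv_eq[OF mult_inverse] vec_eq_iff matrix_vector_mult_def axis_def inj_eq
        if_distrib[of "\<lambda>x. _ * x"] cong: if_cong)
  have mv: "(m *v x) $ s k = m $ s k $ k * x $ k" for x k
  proof -
    have "m $ s k $ c = 0" if "c \<noteq> k" for c
      using nonzero_iff[of "s k" c] that bij_is_inj[OF bij] by (metis injD)
    then have "(m *v x) $ s k = (\<Sum>c\<in>UNIV. if c = k then m $ s k $ k * x $ k else 0)"
      unfolding matrix_vector_mult_def vec_lambda_beta
      by (intro sum.cong) auto
    then show ?thesis by simp
  qed
  have "m $ s a $ a \<noteq> 0" for a by (simp add: nonzero_iff)
  then show ?thesis
    using bil by (simp add: struct_coeff_def act_def ax mv bilinear_lmul bilinear_rmul)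
qed

lemma weights_act:
  assumes "\<mu> \<in> V_space"
  shows "weights (act m \<mu>) = relabel s ` weights \<mu>"
proof -
  have "weights (act m \<mu>) = {alpha (s i) (s j) (s k) | i j k. struct_coeff (act m \<mu>) (s i) (s j) (s k) \<noteq> 0}"
    unfolding weights_eq[OF act_in_V_space[OF assms]]
  proof (rule Collect_cong)
    fix x
    show "(\<exists>i j k. x = alpha i j k \<and> struct_coeff (act m \<mu>) i j k \<noteq> 0) \<longleftrightarrow>
      (\<exists>i j k. x = alpha (s i) (s j) (s k) \<and> struct_coeff (act m \<mu>) (s i) (s j) (s k) \<noteq> 0)"
      (is "?L \<longleftrightarrow> ?R")
    proof
      assume ?L
      then obtain i j k where "x = alpha i j k" "struct_coeff (act m \<mu>) i j k \<noteq> 0" by blast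
      moreover obtain i' j' k' where "i = s i'" "j = s j'" "k = s k'"
        using bij by (meson bij_pointE)
      ultimately show ?R by blast
    qed blast
  qed
  also have "\<dots> = relabel s ` weights \<mu>"
    unfolding weights_eq[OF assms] struct_coeff_act_nonzero_iff[OF assms]
    by (auto simp: relabel_alpha[OF bij, symmetric])
  finally show ?thesis .
qed

lemma act_in_W_set_iff:
  assumes "\<mu> \<in> V_space"
  shows "act m \<mu> \<in> W_set (relabel s \<beta>) \<longleftrightarrow> \<mu> \<in> W_set \<beta>"
  using assms by (simp add: W_set_iff act_in_V_space weights_act norm_relabel inner_relabel bij)

text \<open>The isometry \<open>relabel s\<close> transports both the hull and the half-space
  condition, and these two characterise the minimal vector.\<close>

lemma beta_of_act:
  assumes "\<mu> \<in> V_nz"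
  shows "beta_of (act m \<mu>) = relabel s (beta_of \<mu>)"
proof (rule beta_of_eqI)
  have V: "\<mu> \<in> V_space" using assms by (simp add: V_nz_def)
  show "act m \<mu> \<in> V_nz" using assms invertible by (rule act_in_V_nz)
  show "relabel s (beta_of \<mu>) \<in> convex hull weights (act m \<mu>)"
    using beta_of_minimal(1)[OF assms]
    by (simp add: weights_act[OF V] convex_hull_linear_image[OF linear_relabel, symmetric])
  show "act m \<mu> \<in> W_set (relabel s (beta_of \<mu>))"
    using in_W_set_beta_of[OF assms] V by (simp add: act_in_W_set_iff)
qed

end

section \<open>The chamber as a fundamental domain for permutations of the diagonal\<close>

lemma monomial_permutation_matrix:
  "bij s \<Longrightarrow> monomial (\<chi> i j. if i = s j then 1 else 0) s"
  by (simp add: monomial_def)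

lemma ex_sorting_bij:
  fixes d :: "'n::{finite,linorder} \<Rightarrow> real"
  obtains t :: "'n \<Rightarrow> 'n" where "bij t" "mono (\<lambda>i. d (t i))"
proof -
  define ys where "ys = sort_key d (sorted_list_of_set (UNIV :: 'n set))"
  \<comment> \<open>The zero-based rank of i in the order of the index type, used as a position in
    the list sorted by d.\<close>
  define f where "f i = card {..<i}" for i :: 'n
  have f_less: "f i < f j" if "i < j" for i j
    unfolding f_def using that by (intro psubset_card_mono) auto
  have f_mono: "f i \<le> f j" if "i \<le> j" for i j
    using f_less[of i j] that by (cases "i = j") (auto intro: less_imp_le)
  have len: "length ys = CARD('n)" by (simp add: ys_def)
  have lt: "f i < length ys" for i
    unfolding f_def len by (intro psubset_card_mono) auto
  have "inj (\<lambda>i. ys ! f i)"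
  proof (rule injI)
    fix i j assume "ys ! f i = ys ! f j"
    then have "f i = f j"
      using lt nth_eq_iff_index_eq[of ys] by (simp add: ys_def)
    then show "i = j"
      using f_less[of i j] f_less[of j i] by (cases i j rule: linorder_cases) auto
  qed
  then have "bij (\<lambda>i. ys ! f i)"
    by (simp add: bij_def finite_UNIV_inj_surj)
  moreover have "mono (\<lambda>i. d (ys ! f i))"
  proof (rule monoI)
    fix i j :: 'n assume "i \<le> j"
    then have "map d ys ! f i \<le> map d ys ! f j"
      using lt f_mono by (intro sorted_nth_mono) (simp_all add: ys_def)
    then show "d (ys ! f i) \<le> d (ys ! f j)" using lt by simp
  qed
  ultimately show ?thesis by (rule that)
qed

lemma ex_relabel_in_weyl_chamber:
  fixes \<beta> :: "('n::{finite,linorder}) rmat"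
  assumes "\<beta> \<in> diag_space"
  obtains s where "bij s" "relabel s \<beta> \<in> weyl_chamber"
proof -
  obtain t :: "'n \<Rightarrow> 'n" where t: "bij t" "mono (\<lambda>i. \<beta> $ t i $ t i)"
    using ex_sorting_bij[of "\<lambda>i. \<beta> $ i $ i"] by blast
  have "relabel (inv t) \<beta> = (\<chi> i j. \<beta> $ t i $ t j)"
    using t by (simp add: relabel_def inv_inv_eq)
  then have "relabel (inv t) \<beta> \<in> weyl_chamber"
    using t assms by (auto simp: weyl_chamber_def diag_space_def mono_def bij_def inj_eq)
  then show ?thesis using that bij_imp_bij_inv[OF t(1)] by blast
qed

text \<open>Listed along the index order, both functions give sorted lists with the same multiset of
  values, and such lists coincide.\<close>

lemma mono_rearrangement_eq:
  fixes d e :: "'n::{finite,linorder} \<Rightarrow> real" and t :: "'n \<Rightarrow> 'n"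
  assumes "mono d" "mono e" "bij t" "e = d \<circ> t"
  shows "d = e"
proof -
  define xs where "xs = sorted_list_of_set (UNIV :: 'n set)"
  have sorted: "sorted (map f xs)" if "mono f" for f :: "'n \<Rightarrow> real"
    using that by (simp add: xs_def mono_def sorted_wrt_map sorted_wrt_mono_rel[OF _ sorted_sorted_list_of_set])
  have ms: "mset xs = mset_set UNIV" by (metis xs_def mset_sorted_list_of_multiset sorted_list_of_mset_set)
  have "image_mset e (mset_set UNIV) = image_mset d (image_mset t (mset_set UNIV))"
    by (simp add: assms(4) multiset.map_comp o_def)
  also have "image_mset t (mset_set UNIV) = mset_set UNIV"
    using assms(3) by (simp only: image_mset_mset_set[OF bij_is_inj] bij_is_surj)
  finally have "mset (map e xs) = mset (map d xs)" by (simp add: ms)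
  then have "map e xs = map d xs"
    using sorted[OF assms(1)] sorted[OF assms(2)] by (metis properties_for_sort)
  then show ?thesis by (auto simp: xs_def)
qed

lemma relabel_weyl_chamber_eq:
  assumes s: "bij s" and \<beta>: "\<beta> \<in> weyl_chamber" and s\<beta>: "relabel s \<beta> \<in> weyl_chamber"
  shows "relabel s \<beta> = \<beta>"
proof -
  have "(\<lambda>i. \<beta> $ i $ i) = (\<lambda>i. relabel s \<beta> $ i $ i)"
  proof (rule mono_rearrangement_eq)
    show "bij (inv s)" using s by (rule bij_imp_bij_inv)
    show "mono (\<lambda>i. \<beta> $ i $ i)" "mono (\<lambda>i. relabel s \<beta> $ i $ i)"
      using \<beta> s\<beta> by (auto simp: weyl_chamber_def intro!: monoI)
  qed (simp add: relabel_def fun_eq_iff)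
  then have "relabel s \<beta> $ i $ i = \<beta> $ i $ i" for i
    by metis
  then have "relabel s \<beta> $ i $ j = \<beta> $ i $ j" for i j
    using \<beta> s\<beta> by (cases "i = j") (auto simp: weyl_chamber_def diag_space_def)
  then show ?thesis by (simp add: vec_eq_iff)
qed


section \<open>The strata\<close>

lemma stratum_iff:
  "\<mu> \<in> stratum \<beta> \<longleftrightarrow> \<mu> \<in> V_nz \<and> (\<exists>g. invertible g \<and> beta_of (act g \<mu>) = \<beta>) \<and>
    (\<forall>g. invertible g \<longrightarrow> norm (beta_of (act g \<mu>)) \<le> norm \<beta>)"
  unfolding stratum_def by blast

lemma invertible_mat_1: "invertible (mat 1 :: real ^ 'n ^ 'n)"
  unfolding invertible_def by (intro exI[of _ "mat 1"]) simp

lemma stratum_norm_ge: "\<mu> \<in> stratum \<beta> \<Longrightarrow> norm (beta_of \<mu>) \<le> norm \<beta>"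
  using invertible_mat_1 act_mat_1 unfolding stratum_iff by metis

lemma act_in_stratum:
  assumes \<mu>: "\<mu> \<in> stratum \<beta>" and g: "invertible g"
  shows "act g \<mu> \<in> stratum \<beta>"
proof -
  obtain h where h: "invertible h" "beta_of (act h \<mu>) = \<beta>"
    using \<mu> by (auto simp: stratum_iff)
  have "act (h ** matrix_inv g) (act g \<mu>) = act h \<mu>"
    using h g by (simp add: act_mult invertible_matrix_inv act_matrix_inv)
  then have "\<exists>h. invertible h \<and> beta_of (act h (act g \<mu>)) = \<beta>"
    using h g invertible_matrix_inv invertible_mult by metis
  moreover have "norm (beta_of (act h (act g \<mu>))) \<le> norm \<beta>" if "invertible h" for h
    using \<mu> g that by (simp add: act_mult[symmetric] stratum_iff invertible_mult)
  ultimately show ?thesis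
    using \<mu> g by (simp add: stratum_iff act_in_V_nz)
qed

lemma act_in_stratum_iff:
  assumes "invertible g"
  shows "act g \<mu> \<in> stratum \<beta> \<longleftrightarrow> \<mu> \<in> stratum \<beta>"
  using assms act_in_stratum act_in_stratum[OF _ invertible_matrix_inv] act_matrix_inv(1) by metis

text \<open>If \<mu> itself attains the maximal norm of its orbit, its own minimal vector is a
  legitimate label. It may differ from \<gamma>, as neither is assumed to lie in the
  chamber.\<close>

lemma in_stratum_if_beta_of_eq:
  assumes "\<mu> \<in> stratum \<gamma>" "norm (beta_of \<mu>) = norm \<gamma>"
  shows "\<mu> \<in> stratum (beta_of \<mu>)"
  using assms invertible_mat_1 act_mat_1[of \<mu>] unfolding stratum_iff by metis

text \<open>Finitely many minimal vectors give an orbit point of maximal norm; a permutation matrix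
  then sorts its minimal vector into the chamber without changing the norm.\<close>

lemma ex_stratum:
  fixes \<mu> :: "('n::{finite,linorder}) product"
  assumes \<mu>: "\<mu> \<in> V_nz"
  obtains \<beta> where "\<beta> \<in> strata_index" "\<mu> \<in> stratum \<beta>"
proof -
  let ?O = "{beta_of (act g \<mu>) | g. invertible g}"
  have fin: "finite (norm ` ?O)"
    by (rule finite_subset[of _ "norm ` range beta_of"]) (use finite_range_beta_of in auto)
  have ne: "norm ` ?O \<noteq> {}"
    using invertible_mat_1 by blast
  obtain g where g: "invertible g" "norm (beta_of (act g \<mu>)) = Max (norm ` ?O)"
    using Max_in[OF fin ne] by force
  have nz: "act g \<mu> \<in> V_nz" using \<mu> g(1) by (rule act_in_V_nz)
  obtain s where s: "bij s" "relabel s (beta_of (act g \<mu>)) \<in> weyl_chamber"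
    using ex_relabel_in_weyl_chamber[OF beta_of_in_diag_space[OF nz]] by blast
  interpret monomial "\<chi> i j. if i = s j then 1 else 0" s
    using s(1) by (rule monomial_permutation_matrix)
  let ?m = "(\<chi> i j. if i = s j then 1 else 0) :: 'n rmat" and ?\<beta> = "relabel s (beta_of (act g \<mu>))"
  have "beta_of (act (?m ** g) \<mu>) = ?\<beta>"
    by (simp add: act_mult invertible g beta_of_act nz)
  moreover have "norm (beta_of (act h \<mu>)) \<le> norm ?\<beta>" if "invertible h" for h
    unfolding norm_relabel[OF s(1)] g(2) using that by (intro Max_ge[OF fin]) blast
  ultimately have "\<mu> \<in> stratum ?\<beta>"
    using \<mu> invertible_mult[OF invertible g(1)] unfolding stratum_iff by blast
  then show ?thesis
    using that s(2) unfolding strata_index_def by blast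
qed

lemma lower_triangular_act_in_W_set_iff:
  assumes "b \<in> lower_triangular" "\<beta> \<in> weyl_chamber"
  shows "act b \<mu> \<in> W_set \<beta> \<longleftrightarrow> \<mu> \<in> W_set \<beta>"
  using lower_triangular_act_W_set[OF _ assms(2)] assms(1) lower_triangular_matrix_inv
    act_matrix_inv(1)[OF lower_triangular_invertible] by metis

text \<open>By the Bruhat decomposition some element of the orbit lies both in \<open>W_set \<beta>\<close> and in a Weyl group
  translate of \<open>W_set \<beta>'\<close>; maximality of both norms then forces its minimal vector to be \<open>\<beta>\<close> as well as
  that translate of \<open>\<beta>'\<close>.\<close>

lemma stratum_unique:
  assumes \<beta>: "\<beta> \<in> weyl_chamber" "\<mu> \<in> stratum \<beta>" and \<beta>': "\<beta>' \<in> weyl_chamber" "\<mu> \<in> stratum \<beta>'"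
  shows "\<beta> = \<beta>'"
proof -
  have nz: "\<mu> \<in> V_nz" using \<beta>(2) by (simp add: stratum_iff)
  obtain g1 where g1: "invertible g1" "beta_of (act g1 \<mu>) = \<beta>"
    using \<beta> by (auto simp: stratum_iff)
  obtain g2 where g2: "invertible g2" "beta_of (act g2 \<mu>) = \<beta>'"
    using \<beta>' by (auto simp: stratum_iff)
  \<comment> \<open>This g carries \<open>act g1 \<mu>\<close> to \<open>act g2 \<mu>\<close>, the
    two points of the orbit whose minimal vectors are the competing labels.\<close>
  define g where "g = g2 ** matrix_inv g1"
  have g: "invertible g"
    using g1 g2 by (simp add: g_def invertible_mult invertible_matrix_inv)
  obtain a b s where a: "a \<in> lower_triangular" and b: "b \<in> lower_triangular" and s: "bij s"
    and mon: "\<And>i j. (a ** g ** b) $ i $ j \<noteq> 0 \<longleftrightarrow> i = s j"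
    using lower_triangular_monomial_decomposition[OF g] by metis
  interpret monomial "a ** g ** b" s
    using s mon by unfold_locales
  note inv_a = lower_triangular_invertible[OF a] and inv_b = lower_triangular_invertible[OF b]
  \<comment> \<open>The choice makes the monomial matrix send \<nu> to
    \<open>act a (act g2 \<mu>)\<close>; the triangular factors are thus absorbed at either end,
    where they preserve \<open>W_set \<beta>\<close> and \<open>W_set \<beta>'\<close>.\<close>
  define \<nu> where "\<nu> = act (matrix_inv b) (act g1 \<mu>)"
  have \<nu>_in: "\<nu> \<in> stratum \<beta>" "\<nu> \<in> stratum \<beta>'"
    using \<beta> \<beta>' g1 inv_b by (simp_all add: \<nu>_def act_in_stratum_iff invertible_matrix_inv)
  then have \<nu>: "\<nu> \<in> V_nz" by (simp add: stratum_iff)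
  have "\<nu> \<in> W_set \<beta>"
    using in_W_set_beta_of[OF act_in_V_nz[OF nz g1(1)]] g1(2) \<beta>(1) lower_triangular_matrix_inv[OF b]
    by (simp add: \<nu>_def lower_triangular_act_in_W_set_iff)
  then have eq: "beta_of \<nu> = \<beta>"
    using W_set_norm_le(2)[OF \<nu>] stratum_norm_ge \<nu>_in by blast
  have "act (a ** g ** b) \<nu> = act a (act g2 \<mu>)"
    using g1 g2 g inv_a inv_b
    by (simp add: \<nu>_def act_mult invertible_mult act_matrix_inv)
      (simp add: g_def act_mult invertible_matrix_inv act_matrix_inv)
  moreover have "act a (act g2 \<mu>) \<in> W_set \<beta>'"
    using in_W_set_beta_of[OF act_in_V_nz[OF nz g2(1)]] g2(2) \<beta>'(1) a
    by (simp add: lower_triangular_act_in_W_set_iff)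
  ultimately have "beta_of (act (a ** g ** b) \<nu>) = \<beta>'"
    using W_set_norm_le(2)[OF act_in_V_nz[OF \<nu> invertible]] act_in_stratum[OF \<nu>_in(2) invertible]
      stratum_norm_ge by metis
  then have "\<beta>' = relabel s \<beta>"
    using beta_of_act[OF \<nu>] eq by simp
  then show ?thesis
    using relabel_weyl_chamber_eq[OF s \<beta>(1)] \<beta>'(1) by simp
qed

lemma finite_strata_index: "finite strata_index"
  by (rule finite_subset[OF _ finite_range_beta_of]) (auto simp: strata_index_def stratum_iff)

lemma strata_indexD: "\<beta> \<in> strata_index \<Longrightarrow> \<beta> \<in> weyl_chamber"
  by (simp add: strata_index_def)

lemma stratum_subset_V_nz: "stratum \<beta> \<subseteq> V_nz"
  by (auto simp: stratum_iff)

lemma Union_stratum: "(\<Union>\<beta>\<in>strata_index. stratum \<beta>) = V_nz"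
  using stratum_subset_V_nz by (blast elim: ex_stratum)

lemma disjoint_stratum: "disjoint_family_on stratum strata_index"
  using stratum_unique unfolding disjoint_family_on_def strata_index_def by blast

text \<open>If \<beta>' labels the stratum of \<mu>, then \<open>norm (beta_of \<mu>)\<close> lies
  between \<open>norm \<beta>\<close> and \<open>norm \<beta>'\<close>. Without strict growth all
  three agree, so \<beta> is the minimal vector of \<mu> and itself a maximal one.\<close>

lemma W_set_subset:
  "W_set \<beta> \<inter> V_nz \<subseteq> stratum \<beta> \<union> (\<Union>\<beta>'\<in>{\<beta>' \<in> strata_index. norm \<beta>' > norm \<beta>}. stratum \<beta>')"
proof
  fix \<mu> assume \<mu>: "\<mu> \<in> W_set \<beta> \<inter> V_nz"
  then obtain \<beta>' where \<beta>': "\<beta>' \<in> strata_index" "\<mu> \<in> stratum \<beta>'"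
    using ex_stratum by blast
  have le: "norm \<beta> \<le> norm (beta_of \<mu>)" "norm (beta_of \<mu>) \<le> norm \<beta>'"
    using \<mu> \<beta>' W_set_norm_le(1) stratum_norm_ge by blast+
  show "\<mu> \<in> stratum \<beta> \<union> (\<Union>\<beta>'\<in>{\<beta>' \<in> strata_index. norm \<beta>' > norm \<beta>}. stratum \<beta>')"
  proof (cases "norm \<beta>' > norm \<beta>")
    case True
    then show ?thesis using \<beta>' by blast
  next
    case False
    then have "norm (beta_of \<mu>) = norm \<beta>'" "norm (beta_of \<mu>) \<le> norm \<beta>" using le by linarith+
    then have "\<mu> \<in> stratum (beta_of \<mu>)" "beta_of \<mu> = \<beta>"
      using in_stratum_if_beta_of_eq[OF \<beta>'(2)] W_set_norm_le(2) \<mu> by blast+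
    then show ?thesis by simp
  qed
qed

lemma stratum_Int_W_set: "stratum \<beta> \<inter> W_set \<beta> = {\<mu> \<in> stratum \<beta>. beta_of \<mu> = \<beta>}"
proof -
  have "beta_of \<mu> = \<beta>" if "\<mu> \<in> stratum \<beta>" "\<mu> \<in> W_set \<beta>" for \<mu>
    using that stratum_norm_ge W_set_norm_le(2) stratum_subset_V_nz by blast
  moreover have "\<mu> \<in> W_set (beta_of \<mu>)" if "\<mu> \<in> stratum \<beta>" for \<mu>
    using that in_W_set_beta_of stratum_subset_V_nz by blast
  ultimately show ?thesis by blast
qed

section \<open>Orthogonal representatives of a stratum\<close>

lemma orthogonal_matrix_invertible: "orthogonal_matrix h \<Longrightarrow> invertible h"
  unfolding orthogonal_matrix_def invertible_def by blast

lemma ex_orthogonal_act_in_W_set: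
  assumes \<beta>: "\<beta> \<in> weyl_chamber" and \<mu>: "\<mu> \<in> stratum \<beta>"
  obtains h where "orthogonal_matrix h" "act h \<mu> \<in> W_set \<beta>"
proof -
  obtain g where g: "invertible g" "beta_of (act g \<mu>) = \<beta>"
    using \<mu> by (auto simp: stratum_iff)
  obtain a where a: "a \<in> lower_triangular" "orthogonal_matrix (a ** g)"
    using lower_triangular_orthogonal_decomposition[OF g(1)] by blast
  have "act g \<mu> \<in> W_set \<beta>"
    using in_W_set_beta_of[OF act_in_V_nz[OF _ g(1)]] g(2) \<mu> by (auto simp: stratum_iff)
  then have "act (a ** g) \<mu> \<in> W_set \<beta>"
    using a g \<beta> by (simp add: act_mult lower_triangular_invertible lower_triangular_act_W_set)
  then show ?thesis using that a by blast
qed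

lemma stratum_eq_orthogonal_orbit:
  assumes \<beta>: "\<beta> \<in> weyl_chamber"
  shows "stratum \<beta> = {act h \<mu> | h \<mu>. orthogonal_matrix h \<and> \<mu> \<in> stratum \<beta> \<inter> W_set \<beta>}"
proof
  show "stratum \<beta> \<subseteq> {act h \<mu> | h \<mu>. orthogonal_matrix h \<and> \<mu> \<in> stratum \<beta> \<inter> W_set \<beta>}"
  proof
    fix \<mu> assume \<mu>: "\<mu> \<in> stratum \<beta>"
    obtain h where h: "orthogonal_matrix h" "act h \<mu> \<in> W_set \<beta>"
      using ex_orthogonal_act_in_W_set[OF \<beta> \<mu>] by blast
    have inv: "invertible h" using h(1) by (rule orthogonal_matrix_invertible)
    have "matrix_inv h = transpose h"
      using h(1) by (intro matrix_inv_eq) (simp add: orthogonal_matrix_def)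
    then have "orthogonal_matrix (matrix_inv h)" using h(1) by simp
    moreover have "\<mu> = act (matrix_inv h) (act h \<mu>)"
      using inv by (simp add: act_matrix_inv)
    moreover have "act h \<mu> \<in> stratum \<beta> \<inter> W_set \<beta>"
      using h(2) act_in_stratum[OF \<mu> inv] by blast
    ultimately show "\<mu> \<in> {act h \<mu> | h \<mu>. orthogonal_matrix h \<and> \<mu> \<in> stratum \<beta> \<inter> W_set \<beta>}"
      by blast
  qed
qed (auto intro: act_in_stratum orthogonal_matrix_invertible)


section \<open>Closures of strata\<close>

lemma compact_orthogonal_matrix: "compact {h :: real ^ 'n ^ 'n. orthogonal_matrix h}"
proof -
  have "closed {h :: real ^ 'n ^ 'n. \<forall>i j. (\<Sum>k\<in>UNIV. h $ k $ i * h $ k $ j) = (if i = j then 1 else 0)}"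
    by (intro closed_Collect_all closed_Collect_eq continuous_intros)
  moreover have "orthogonal_matrix h \<longleftrightarrow>
      (\<forall>i j. (\<Sum>k\<in>UNIV. h $ k $ i * h $ k $ j) = (if i = j then 1 else 0))" for h :: "real ^ 'n ^ 'n"
    by (simp add: orthogonal_matrix matrix_matrix_mult_def transpose_def mat_def vec_eq_iff)
  \<comment> \<open>The squared norm is the trace of h times its transpose, which is the trace of
    the identity.\<close>
  moreover have "norm h \<le> sqrt CARD('n)" if "orthogonal_matrix h" for h :: "real ^ 'n ^ 'n"
    using that by (simp add: norm_eq_sqrt_inner inner_eq_trace orthogonal_matrix_def trace_I)
  then have "bounded {h :: real ^ 'n ^ 'n. orthogonal_matrix h}"
    by (auto simp: bounded_iff)
  ultimately show ?thesis by (simp add: compact_eq_bounded_closed)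
qed

lemma closedin_V_topologyI:
  assumes "closed T"
  shows "closedin V_topology {\<mu> \<in> V_space. (\<chi> i j k. struct_coeff \<mu> i j k) \<in> T}"
proof -
  have "openin V_topology ((\<lambda>\<mu>. \<chi> i j k. struct_coeff \<mu> i j k) -` (- T) \<inter> V_space)"
    using assms unfolding V_topology_def openin_pullback_topology
    by (auto intro!: exI[of _ "- T"])
  moreover have "(\<lambda>\<mu>. \<chi> i j k. struct_coeff \<mu> i j k) -` (- T) \<inter> V_space
      = V_space - {\<mu> \<in> V_space. (\<chi> i j k. struct_coeff \<mu> i j k) \<in> T}"
    by auto
  ultimately show ?thesis
    by (auto simp: closedin_def topspace_V_topology)
qed

text \<open>In coordinates this is the projection, along the compact orthogonal group, of a closed
  set of pairs (h, t). The transpose stands for the inverse, which keeps the defining equations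
  polynomial on all pairs.\<close>

lemma closedin_orthogonal_orbit_W_set:
  fixes \<beta> :: "('n::{finite,linorder}) rmat"
  shows "closedin V_topology {\<mu> \<in> V_space. \<exists>h. orthogonal_matrix h \<and> act h \<mu> \<in> W_set \<beta>}"
proof -
  \<comment> \<open>The implication defining \<open>W_set \<beta>\<close> is read contrapositively:
    coefficients of weights outside the half-space are 0, which is a closed condition.\<close>
  let ?P = "\<lambda>i j k :: 'n. i < j \<and> \<not> (norm \<beta>)\<^sup>2 \<le> \<beta> \<bullet> alpha i j k"
  let ?T = "{p. \<forall>i j k. ?P i j k \<longrightarrow> tensor_act (fst p) (transpose (fst p)) (snd p) $ i $ j $ k = 0}"
  have cont: "continuous_on UNIV (\<lambda>p. tensor_act (fst p) (transpose (fst p)) (snd p) $ i $ j $ k)"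
    for i j k :: 'n
    unfolding tensor_act_def transpose_def vec_lambda_beta by (intro continuous_intros)
  have "closed ?T"
    by (intro closed_Collect_all closed_Collect_imp closed_Collect_eq cont continuous_intros open_Collect_const)
  from closed_compact_projection[OF compact_orthogonal_matrix this]
  have "closedin V_topology {\<mu> \<in> V_space. (\<chi> i j k. struct_coeff \<mu> i j k)
      \<in> {t. \<exists>h. h \<in> {h. orthogonal_matrix h} \<and> (h, t) \<in> ?T}}"
    by (rule closedin_V_topologyI)
  moreover have "act h \<mu> \<in> W_set \<beta> \<longleftrightarrow> (h, \<chi> i j k. struct_coeff \<mu> i j k) \<in> ?T"
    if "orthogonal_matrix h" "\<mu> \<in> V_space" for h \<mu>
  proof -
    have "matrix_inv h = transpose h"
      using that by (intro matrix_inv_eq) (simp add: orthogonal_matrix_def)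
    then show ?thesis
      using that(2) by (auto simp: W_set_def act_in_V_space struct_coeff_act)
  qed
  ultimately show ?thesis by (simp cong: conj_cong)
qed

lemma closure_of_stratum_subset:
  assumes \<beta>: "\<beta> \<in> weyl_chamber"
  shows "V_nz_topology closure_of stratum \<beta>
    \<subseteq> stratum \<beta> \<union> (\<Union>\<beta>'\<in>{\<beta>' \<in> strata_index. norm \<beta>' > norm \<beta>}. stratum \<beta>')"
    (is "_ \<subseteq> ?R")
proof -
  let ?C = "{\<mu> \<in> V_space. \<exists>h. orthogonal_matrix h \<and> act h \<mu> \<in> W_set \<beta>}"
  have "V_nz_topology closure_of stratum \<beta> \<subseteq> V_nz \<inter> ?C"
  proof (rule closure_of_minimal)
    show "stratum \<beta> \<subseteq> V_nz \<inter> ?C"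
    proof
      fix \<mu> assume \<mu>: "\<mu> \<in> stratum \<beta>"
      then obtain h where "orthogonal_matrix h" "act h \<mu> \<in> W_set \<beta>"
        using ex_orthogonal_act_in_W_set[OF \<beta>] by blast
      moreover have "\<mu> \<in> V_nz" using \<mu> by (simp add: stratum_iff)
      ultimately show "\<mu> \<in> V_nz \<inter> ?C" by (auto simp: V_nz_def)
    qed
    show "closedin V_nz_topology (V_nz \<inter> ?C)"
      unfolding V_nz_topology_def
      by (intro closedin_subtopology_Int_closed closedin_orthogonal_orbit_W_set)
  qed
  also have "\<dots> \<subseteq> ?R"
  proof
    fix \<mu> assume \<mu>: "\<mu> \<in> V_nz \<inter> ?C"
    then obtain h where h: "orthogonal_matrix h" "act h \<mu> \<in> W_set \<beta>" by blast
    have inv: "invertible h" using h(1) by (rule orthogonal_matrix_invertible)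
    then have "act h \<mu> \<in> W_set \<beta> \<inter> V_nz"
      using h(2) act_in_V_nz \<mu> by blast
    then have "act h \<mu> \<in> ?R"
      using W_set_subset by (rule rev_subsetD)
    then show "\<mu> \<in> ?R"
      by (simp add: act_in_stratum_iff[OF inv])
  qed
  finally show ?thesis .
qed

text \<open>The union of the strictly longer strata is closed, and removing it from the closure of
  \<open>stratum \<beta>\<close> leaves exactly that stratum.\<close>

lemma locally_closed_stratum:
  fixes \<beta> :: "('n::{finite,linorder}) rmat"
  assumes \<beta>: "\<beta> \<in> strata_index"
  shows "locally_closed_in V_nz_topology (stratum \<beta>)"
proof -
  let ?I = "{\<beta>' \<in> strata_index :: 'n rmat set. norm \<beta>' > norm \<beta>}"
  let ?T = "\<Union>\<beta>'\<in>?I. stratum \<beta>'"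
  have sub: "stratum \<beta>' \<subseteq> V_nz_topology closure_of stratum \<beta>'" for \<beta>' :: "'n rmat"
    by (rule closure_of_subset) (simp add: topspace_V_nz_topology stratum_subset_V_nz)
  \<comment> \<open>By transitivity of the norm order, closures of longer strata add only strata
    that are longer still; hence ?T is a finite union of closures.\<close>
  have "V_nz_topology closure_of stratum \<beta>' \<subseteq> ?T" if "\<beta>' \<in> ?I" for \<beta>'
    using closure_of_stratum_subset[OF strata_indexD, of \<beta>'] that by force
  then have "(\<Union>\<beta>'\<in>?I. V_nz_topology closure_of stratum \<beta>') \<subseteq> ?T"
    by (rule UN_least)
  then have "?T = (\<Union>\<beta>'\<in>?I. V_nz_topology closure_of stratum \<beta>')"
    by (rule equalityI[rotated]) (intro UN_mono subset_refl sub)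
  moreover have "closedin V_nz_topology (\<Union>\<beta>'\<in>?I. V_nz_topology closure_of stratum \<beta>')"
    by (intro closedin_Union finite_imageI finite_subset[OF _ finite_strata_index]) auto
  ultimately have "closedin V_nz_topology ?T"
    by (simp only:)
  then have "openin V_nz_topology (V_nz - ?T)"
    by (simp add: closedin_def topspace_V_nz_topology)
  moreover have "stratum \<beta> = (V_nz - ?T) \<inter> (V_nz_topology closure_of stratum \<beta>)"
  proof -
    have "stratum \<beta> \<inter> ?T = {}"
      using disjoint_stratum \<beta> unfolding disjoint_family_on_def by fastforce
    then show ?thesis
      using closure_of_stratum_subset[OF strata_indexD[OF \<beta>]] sub[of \<beta>] stratum_subset_V_nz[of \<beta>] by blast
  qed
  ultimately show ?thesis
    unfolding locally_closed_in_def using closedin_closure_of by blast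
qed

theorem theorem2p10:
  shows
    "let B = (strata_index :: ('n::{finite,linorder}) rmat set) in
     stratification V_nz_topology stratum B (\<lambda>\<beta>' \<beta>. norm \<beta>' > norm \<beta>) \<and>
     finite B \<and>
     (\<forall>\<beta>\<in>B. \<forall>g. invertible g \<longrightarrow> act g ` stratum \<beta> \<subseteq> stratum \<beta>) \<and>
     (V_nz = (\<Union>\<beta>\<in>B. stratum \<beta>) \<and> disjoint_family_on stratum B) \<and>
     (\<forall>\<beta>\<in>B. V_nz_topology closure_of stratum \<beta> - stratum \<beta>
        \<subseteq> (\<Union>\<beta>'\<in>{\<beta>'\<in>B. norm \<beta>' > norm \<beta>}. stratum \<beta>')) \<and>
     (\<forall>\<beta>\<in>B. locally_closed_in V_nz_topology (stratum \<beta>)) \<and>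
     (\<forall>\<beta>\<in>B. W_set \<beta> - {\<lambda>X Y. 0}
        \<subseteq> stratum \<beta> \<union> (\<Union>\<beta>'\<in>{\<beta>'\<in>B. norm \<beta>' > norm \<beta>}. stratum \<beta>')) \<and>
     (\<forall>\<beta>\<in>B. stratum \<beta> \<inter> W_set \<beta> = {\<mu> \<in> stratum \<beta>. beta_of \<mu> = \<beta>}) \<and>
     (\<forall>\<beta>\<in>B. stratum \<beta> = {act h \<mu> | h \<mu>. orthogonal_matrix h \<and> \<mu> \<in> stratum \<beta> \<inter> W_set \<beta>})"
proof -
  have stratification: "stratification V_nz_topology stratum (strata_index :: 'n rmat set)
      (\<lambda>\<beta>' \<beta>. norm \<beta>' > norm \<beta>)"
    unfolding stratification_def topspace_V_nz_topology Union_stratum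
    using finite_strata_index disjoint_stratum
    by (intro conjI ballI closure_of_stratum_subset strata_indexD) (simp_all add: irreflp_on_def transp_on_def)
  show ?thesis
    unfolding Let_def
  proof (intro conjI ballI allI impI)
    show "V_nz = (\<Union>\<beta>\<in>strata_index. stratum \<beta>)"
      by (simp add: Union_stratum)
    fix \<beta> :: "'n rmat" assume \<beta>: "\<beta> \<in> strata_index"
    then have chamber: "\<beta> \<in> weyl_chamber" by (rule strata_indexD)
    show "act g ` stratum \<beta> \<subseteq> stratum \<beta>" if "invertible g" for g
      using that act_in_stratum by blast
    show "V_nz_topology closure_of stratum \<beta> - stratum \<beta>
        \<subseteq> (\<Union>\<beta>'\<in>{\<beta>' \<in> strata_index. norm \<beta>' > norm \<beta>}. stratum \<beta>')"
      using closure_of_stratum_subset[OF chamber] by blast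
    show "locally_closed_in V_nz_topology (stratum \<beta>)"
      using \<beta> by (rule locally_closed_stratum)
    show "W_set \<beta> - {\<lambda>X Y. 0}
        \<subseteq> stratum \<beta> \<union> (\<Union>\<beta>'\<in>{\<beta>' \<in> strata_index. norm \<beta>' > norm \<beta>}. stratum \<beta>')"
      using W_set_subset[of \<beta>] by (auto simp: W_set_iff V_nz_def)
    show "stratum \<beta> = {act h \<mu> | h \<mu>. orthogonal_matrix h \<and> \<mu> \<in> stratum \<beta> \<inter> W_set \<beta>}"
      using chamber by (rule stratum_eq_orthogonal_orbit)
  qed (rule stratification finite_strata_index disjoint_stratum stratum_Int_W_set)+
qed

end
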